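(* Let $(X,\tau,\mathsf d)$ be an extended metric-topological space. Assume that $p\in(1,\infty)$, $T>0$ and $D\subset\mathbb R$ is countable. Let $(\boldsymbol\eta_i)_{i\in I}$ be a net of Radon probability measures in $(X^D,\tau^* )$ such that for all $t\in D$ the family $\{(\mathrm e_t)_\sharp\boldsymbol\eta_i\}_{i\in I}$ is equi-tight in $\mathcal P(X)$. Then $\{\boldsymbol\eta_i\}_{i\in I}$ has limit points $\boldsymbol\eta\in\mathcal P(X^D)$ in the weak topology induced by $C_b(X^D)$, and any such limit point, along a subnet $\beta:L\to I$, satisfies $$\int\mathscr A_p(\eta,D')\,d\boldsymbol\eta(\eta)\le\liminf_{\ell\in L}\int\mathscr A_p(\eta,D')\,d\boldsymbol\eta_{\beta(\ell)}(\eta)\qquad\forall D'\subset D.$$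
   Context: An extended metric space $(X,\mathsf d)$ is a set with a symmetric $\mathsf d:X\times X\to[0,\infty]$ satisfying the triangle inequality and $\mathsf d(x,y)=0$ iff $x=y$; for a semidistance the last condition is weakened to $\mathsf d(x,x)=0$. For a Hausdorff topology $\tau$ on $X$, $\mathrm{Lip}_b(X,\tau,\mathsf d)$ is the set of bounded, $\mathsf d$-Lipschitz, $\tau$-continuous functions $f:X\to\mathbb R$. $(X,\tau,\mathsf d)$ is an extended metric-topological space if (a) there are $(\tau\times\tau)$-continuous bounded semidistances $\mathsf d_i:X\times X\to[0,\infty)$, $i\in I$, with $\mathsf d=\sup_i\mathsf d_i$; (b) $\tau$ is generated by $\mathrm{Lip}_b(X,\tau,\mathsf d)$. For a Hausdorff space $Y$, $\mathcal P(Y)$ is the set of Radon probability measures on its Borel sets (for every Borel $B$ and $\epsilon>0$ there is a compact $K\subset B$ with $\mu(B\setminus K)<\epsilon$). A family $\mathcal M\subset\mathcal P(Y)$ is equi-tight if for every $\epsilon>0$ there is a compact $K_\epsilon$ with $\sup_{\mu\in\mathcal M}\mu(Y\setminus K_\epsilon)\le\epsilon$. $X^D$ is the space of all maps $\eta:D\to X$, with the product topology $\tau^*$; $\mathrm e_t(\eta)=\eta(t)$. For $D'\subset D$ the $p$-action is $$\mathscr A_p(\eta,D')=\sup\Big\{\sum_{i=0}^{n-1}\frac{\mathsf d^p(\eta(t_{i+1}),\eta(t_i))}{(t_{i+1}-t_i)^{p-1}}:\ t_0<t_1<\dots<t_n,\ t_i\in D'\Big\}\in[0,\infty].$$ *)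

theory Defs
  imports "HOL-Probability.Probability"
begin

definition semidistance_on :: "'a set \<Rightarrow> ('a \<Rightarrow> 'a \<Rightarrow> real) \<Rightarrow> bool" where
  "semidistance_on S \<delta> \<longleftrightarrow>
     (\<forall>x\<in>S. \<forall>y\<in>S. 0 \<le> \<delta> x y) \<and>
     (\<forall>x\<in>S. \<delta> x x = 0) \<and>
     (\<forall>x\<in>S. \<forall>y\<in>S. \<delta> x y = \<delta> y x) \<and>
     (\<forall>x\<in>S. \<forall>y\<in>S. \<forall>z\<in>S. \<delta> x z \<le> \<delta> x y + \<delta> y z)"

definition extended_metric_on :: "'a set \<Rightarrow> ('a \<Rightarrow> 'a \<Rightarrow> ennreal) \<Rightarrow> bool" where
  "extended_metric_on S d \<longleftrightarrow>
     (\<forall>x\<in>S. \<forall>y\<in>S. d x y = 0 \<longleftrightarrow> x = y) \<and>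
     (\<forall>x\<in>S. \<forall>y\<in>S. d x y = d y x) \<and>
     (\<forall>x\<in>S. \<forall>y\<in>S. \<forall>z\<in>S. d x z \<le> d x y + d y z)"

definition Lip_b :: "'a topology \<Rightarrow> ('a \<Rightarrow> 'a \<Rightarrow> ennreal) \<Rightarrow> ('a \<Rightarrow> real) set" where
  "Lip_b X d =
     {f. continuous_map X euclideanreal f \<and> bounded (f ` topspace X) \<and>
         (\<exists>C::real. \<forall>x\<in>topspace X. \<forall>y\<in>topspace X.
            ennreal \<bar>f x - f y\<bar> \<le> ennreal C * d x y)}"

text \<open>
  The initial topology on a set \<open>S\<close> with respect to a family \<open>F\<close> of real functions.
  In the uses below \<open>F\<close> contains the constants, so the topological space is all of \<open>S\<close>.
\<close>

definition initial_topology :: "'a set \<Rightarrow> ('a \<Rightarrow> real) set \<Rightarrow> 'a topology" where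
  "initial_topology S F =
     topology_generated_by {{x \<in> S. f x \<in> U} | f U. f \<in> F \<and> open U}"

text \<open>
  The family of semidistances is rendered as a set \<open>\<Delta>\<close> indexed by itself.
\<close>

definition ext_metric_top_space :: "'a topology \<Rightarrow> ('a \<Rightarrow> 'a \<Rightarrow> ennreal) \<Rightarrow> bool" where
  "ext_metric_top_space X d \<longleftrightarrow>
     Hausdorff_space X \<and>
     extended_metric_on (topspace X) d \<and>
     (\<exists>\<Delta> :: ('a \<Rightarrow> 'a \<Rightarrow> real) set.
        (\<forall>\<delta>\<in>\<Delta>. semidistance_on (topspace X) \<delta> \<and>
           (\<exists>B. \<forall>x\<in>topspace X. \<forall>y\<in>topspace X. \<delta> x y \<le> B) \<and>
           continuous_map (prod_topology X X) euclideanreal (\<lambda>(x, y). \<delta> x y)) \<and>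
        (\<forall>x\<in>topspace X. \<forall>y\<in>topspace X. d x y = (SUP \<delta>\<in>\<Delta>. ennreal (\<delta> x y)))) \<and>
     X = initial_topology (topspace X) (Lip_b X d)"

definition borel_of :: "'a topology \<Rightarrow> 'a measure" where
  "borel_of Y = sigma (topspace Y) {U. openin Y U}"

definition radon_prob :: "'a topology \<Rightarrow> 'a measure set" where
  "radon_prob Y =
     {\<mu>. sets \<mu> = sets (borel_of Y) \<and> prob_space \<mu> \<and>
         (\<forall>B\<in>sets \<mu>. \<forall>\<epsilon>>0. \<exists>K. compactin Y K \<and> K \<subseteq> B \<and> measure \<mu> (B - K) < \<epsilon>)}"

definition equi_tight :: "'a topology \<Rightarrow> 'a measure set \<Rightarrow> bool" where
  "equi_tight Y M \<longleftrightarrow>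
     (\<forall>\<epsilon>>0. \<exists>K. compactin Y K \<and> (\<forall>\<mu>\<in>M. measure \<mu> (topspace Y - K) \<le> \<epsilon>))"

definition C_b :: "'a topology \<Rightarrow> ('a \<Rightarrow> real) set" where
  "C_b Y = {f. continuous_map Y euclideanreal f \<and> bounded (f ` topspace Y)}"

definition weak_topology :: "'a topology \<Rightarrow> 'a measure topology" where
  "weak_topology Y = initial_topology (radon_prob Y) ((\<lambda>f \<mu>. integral\<^sup>L \<mu> f) ` C_b Y)"

lemma topspace_weak_topology: "topspace (weak_topology Y) = radon_prob Y"
proof -
  have "(\<lambda>_. 0) \<in> C_b Y"
    by (auto simp: C_b_def intro: finite_imp_bounded finite_subset[of _ "{0}"])
  then have "\<exists>f. f \<in> (\<lambda>f \<mu>. integral\<^sup>L \<mu> f) ` C_b Y" by blast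
  then have "\<exists>f. radon_prob Y = {x \<in> radon_prob Y. f x \<in> (UNIV :: real set)} \<and>
      f \<in> (\<lambda>f \<mu>. integral\<^sup>L \<mu> f) ` C_b Y \<and> open (UNIV :: real set)" by simp
  then show ?thesis
    unfolding weak_topology_def initial_topology_def topology_generated_by_topspace
    by blast
qed

definition directed_set :: "'i set \<Rightarrow> ('i \<Rightarrow> 'i \<Rightarrow> bool) \<Rightarrow> bool" where
  "directed_set I le \<longleftrightarrow>
     I \<noteq> {} \<and> reflp_on I le \<and> transp_on I le \<and> (\<forall>i\<in>I. \<forall>j\<in>I. \<exists>k\<in>I. le i k \<and> le j k)"

definition net_filter :: "'i set \<Rightarrow> ('i \<Rightarrow> 'i \<Rightarrow> bool) \<Rightarrow> 'i filter" where
  "net_filter I le = (INF i\<in>I. principal {j \<in> I. le i j})"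

lemma eventually_net_filter:
  assumes "directed_set I le"
  shows "eventually P (net_filter I le) \<longleftrightarrow> (\<exists>i\<in>I. \<forall>j\<in>I. le i j \<longrightarrow> P j)"
  unfolding net_filter_def
proof (subst eventually_INF_base)
  show "I \<noteq> {}" using assms by (simp add: directed_set_def)
  fix a b assume ab: "a \<in> I" "b \<in> I"
  then obtain k where "k \<in> I" "le a k" "le b k"
    using assms by (auto simp: directed_set_def)
  then show "\<exists>x\<in>I. principal {j \<in> I. le x j} \<le> inf (principal {j \<in> I. le a j}) (principal {j \<in> I. le b j})"
    using assms ab by (intro bexI[of _ k]) (auto simp: directed_set_def dest: transp_onD)
qed (auto simp: eventually_principal)

text \<open>
  \<open>\<beta> : L \<rightarrow> I\<close> defines a subnet (in the sense of Kelley: eventually beyond every index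
  of \<open>I\<close>, monotonicity is not required).
\<close>

definition subnet_map ::
    "'i set \<Rightarrow> ('i \<Rightarrow> 'i \<Rightarrow> bool) \<Rightarrow> 'l set \<Rightarrow> ('l \<Rightarrow> 'l \<Rightarrow> bool) \<Rightarrow> ('l \<Rightarrow> 'i) \<Rightarrow> bool" where
  "subnet_map I le L leL \<beta> \<longleftrightarrow>
     directed_set L leL \<and> \<beta> \<in> L \<rightarrow> I \<and>
     (\<forall>i\<in>I. \<exists>l\<^sub>0\<in>L. \<forall>l\<in>L. leL l\<^sub>0 l \<longrightarrow> le i (\<beta> l))"

definition limit_along_subnet ::
    "'b topology \<Rightarrow> 'i set \<Rightarrow> ('i \<Rightarrow> 'i \<Rightarrow> bool) \<Rightarrow> ('i \<Rightarrow> 'b) \<Rightarrow>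
     'l set \<Rightarrow> ('l \<Rightarrow> 'l \<Rightarrow> bool) \<Rightarrow> ('l \<Rightarrow> 'i) \<Rightarrow> 'b \<Rightarrow> bool" where
  "limit_along_subnet Z I le x L leL \<beta> z \<longleftrightarrow>
     subnet_map I le L leL \<beta> \<and> limitin Z (\<lambda>l. x (\<beta> l)) z (net_filter L leL)"

text \<open>
  A limit point of a net is a limit of some subnet. A type for the index set of the subnet
  has to be chosen; pairs of an index and a neighbourhood suffice, since a cluster point \<open>z\<close> is
  the limit along \<open>{(i, U). z \<in> U \<and> x i \<in> U}\<close>.
\<close>

definition net_limit_point ::
    "'b topology \<Rightarrow> 'i set \<Rightarrow> ('i \<Rightarrow> 'i \<Rightarrow> bool) \<Rightarrow> ('i \<Rightarrow> 'b) \<Rightarrow> 'b \<Rightarrow> bool" where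
  "net_limit_point Z I le x z \<longleftrightarrow>
     (\<exists>(L :: ('i \<times> 'b set) set) leL \<beta>. limit_along_subnet Z I le x L leL \<beta> z)"

definition ennpowr :: "ennreal \<Rightarrow> real \<Rightarrow> ennreal" where
  "ennpowr x p = (if x = \<infinity> then \<infinity> else ennreal (enn2real x powr p))"

definition p_action ::
    "('a \<Rightarrow> 'a \<Rightarrow> ennreal) \<Rightarrow> real \<Rightarrow> (real \<Rightarrow> 'a) \<Rightarrow> real set \<Rightarrow> ennreal" where
  "p_action d p \<eta> D' =
     Sup {(\<Sum>i<n. ennpowr (d (\<eta> (t (Suc i))) (\<eta> (t i))) p / ennreal ((t (Suc i) - t i) powr (p - 1)))
          | (n::nat) (t :: nat \<Rightarrow> real). (\<forall>i\<le>n. t i \<in> D') \<and> (\<forall>i<n. t i < t (Suc i))}"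

text \<open>
  The space of all maps from \<open>D\<close> to \<open>X\<close>, represented by extensional functions.
\<close>

abbreviation path_space :: "'a topology \<Rightarrow> real set \<Rightarrow> (real \<Rightarrow> 'a) topology" where
  "path_space X D \<equiv> product_topology (\<lambda>_. X) D"

end

theory Submission
  imports Defs
begin

text \<open>
  Equi-tightness of the marginals gives, by Tychonoff's theorem and countability of \<open>D\<close>,
  equi-tightness in the path space. Refine the net to an ultrafilter: the limits
  \<open>\<nu> G = lim H\<^sub>i G\<close> exist for all open \<open>G\<close> and form a finitely additive content, which Halmos'
  construction turns into a Radon measure \<open>\<mu>\<close> with \<open>\<mu> G \<le> \<nu> G\<close>. Tightness gives \<open>\<mu>\<close> total
  mass one, and the inequality on open sets yields \<open>\<integral>f d\<mu> \<le> lim \<integral>f dH\<^sub>i\<close> for bounded continuous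
  \<open>f\<close> by a layer-cake argument; applied to \<open>f\<close> and to \<open>-f\<close> this is weak convergence.

  For the semicontinuity, the action is pointwise the supremum of the nonnegative bounded continuous
  functions below it, because \<open>d\<close> is a supremum of bounded continuous semidistances. Hence its
  superlevel sets are unions of cozero sets; a compact subset of such a union is separated from its
  complement by a bounded continuous function. Inner regularity of the limit then gives
  \<open>\<mu> G \<le> liminf H\<^sub>l G\<close> for these sets, and the same layer-cake argument applies.
\<close>

subsection \<open>Limits along ultrafilters\<close>

text \<open>Zorn's lemma on the proper filters below \<open>F\<close>, with finer filters counted as
  larger. A nonempty chain is a filter base, so its infimum is still proper. For a maximal
  \<open>U\<close>, adding \<open>P\<close> as a constraint either gives \<open>bot\<close>, so that
  the negation of \<open>P\<close> holds eventually, or returns \<open>U\<close> itself.\<close>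

lemma ultrafilter_exists:
  fixes F :: "'a filter"
  assumes "F \<noteq> bot"
  obtains U where "U \<noteq> bot" "U \<le> F" "\<And>P. eventually P U \<or> eventually (\<lambda>x. \<not> P x) U"
proof -
  let ?A = "{G. G \<noteq> bot \<and> G \<le> F}"
  let ?R = "\<lambda>G H :: 'a filter. H \<le> G"
  have "\<exists>U\<in>?A. \<forall>G\<in>?A. G \<le> U \<longrightarrow> G = U"
  proof (rule predicate_Zorn)
    show "partial_order_on ?A (relation_of ?R ?A)"
      by (auto simp: partial_order_on_def preorder_on_def relation_of_def refl_on_def
          intro: transI antisymI)
  next
    fix C assume "C \<in> Chains (relation_of ?R ?A)"
    then have C: "C \<subseteq> ?A" and chain: "\<And>G H. G \<in> C \<Longrightarrow> H \<in> C \<Longrightarrow> G \<le> H \<or> H \<le> G"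
      by (auto simp: Chains_def relation_of_def)
    show "\<exists>u\<in>?A. \<forall>a\<in>C. u \<le> a"
    proof (cases "C = {}")
      case True
      then show ?thesis using assms by auto
    next
      case False
      have "eventually P (Inf C) \<longleftrightarrow> (\<exists>G\<in>C. eventually P G)" for P
        using False
      proof (rule eventually_Inf_base)
        fix G H assume "G \<in> C" "H \<in> C"
        then show "\<exists>x\<in>C. x \<le> inf G H" using chain[of G H] by (auto simp: le_inf_iff)
      qed
      then have "Inf C \<noteq> bot"
        using C by (auto simp: trivial_limit_def)
      moreover obtain G where "G \<in> C" using False by auto
      then have "Inf C \<le> F" using C by (auto intro: Inf_lower2)
      ultimately show ?thesis by (auto intro: Inf_lower)
    qed
  qed
  then obtain U where U: "U \<noteq> bot" "U \<le> F" and max: "\<And>G. G \<noteq> bot \<Longrightarrow> G \<le> F \<Longrightarrow> G \<le> U \<Longrightarrow> G = U"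
    by auto
  show thesis
  proof (rule that[OF U])
    fix P
    show "eventually P U \<or> eventually (\<lambda>x. \<not> P x) U"
    proof (cases "inf U (principal {x. P x}) = bot")
      case True
      then show ?thesis
        by (auto simp: trivial_limit_def eventually_inf_principal)
    next
      case False
      then have "inf U (principal {x. P x}) = U"
        using U by (intro max) (auto intro: le_infI1)
      moreover have "eventually P (inf U (principal {x. P x}))"
        by (simp add: eventually_inf_principal)
      ultimately show ?thesis by simp
    qed
  qed
qed

text \<open>A value \<open>c\<close> strictly between the two limits would be decided by the
  ultrafilter: eventually \<open>f x < c\<close> or eventually \<open>c \<le> f x\<close>. The first
  contradicts \<open>c < Limsup U f\<close>, the second \<open>Liminf U f < c\<close>.\<close>

lemma ultrafilter_tendsto_Liminf:
  fixes f :: "'a \<Rightarrow> ennreal"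
  assumes "U \<noteq> bot" and ultra: "\<And>P. eventually P U \<or> eventually (\<lambda>x. \<not> P x) U"
  shows "(f \<longlongrightarrow> Liminf U f) U"
proof -
  have "Limsup U f \<le> Liminf U f"
  proof (rule ccontr)
    assume "\<not> Limsup U f \<le> Liminf U f"
    then obtain c where c: "Liminf U f < c" "c < Limsup U f"
      using dense by (auto simp: not_le)
    have "\<not> eventually (\<lambda>x. f x < c) U"
      using c(2) by (metis (mono_tags, lifting) Limsup_bounded eventually_mono less_imp_le not_le)
    then have "eventually (\<lambda>x. c \<le> f x) U"
      using ultra[of "\<lambda>x. f x < c"] by (simp add: not_less)
    then have "c \<le> Liminf U f" by (rule Liminf_bounded)
    with c(1) show False by simp
  qed
  then show ?thesis
    using assms(1) by (intro tendsto_iff_Liminf_eq_Limsup[THEN iffD2]) (auto intro: antisym Liminf_le_Limsup)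
qed

section \<open>Adding suprema and infima in the extended half-line\<close>

lemma SUP_add_SUP_le_ennreal:
  fixes f :: "'a \<Rightarrow> ennreal" and g :: "'b \<Rightarrow> ennreal"
  assumes "A \<noteq> {}" "B \<noteq> {}" "\<And>a b. a \<in> A \<Longrightarrow> b \<in> B \<Longrightarrow> f a + g b \<le> c"
  shows "(SUP a\<in>A. f a) + (SUP b\<in>B. g b) \<le> c"
  using assms
  by (auto simp: ennreal_SUP_add_left[symmetric] ennreal_SUP_add_right intro!: SUP_least)

text \<open>Adding \<open>c\<close> is monotone and continuous from the right, hence commutes with
  nonempty infima, also for infinite \<open>c\<close>.\<close>

lemma INF_add_const_ennreal:
  fixes f :: "'a \<Rightarrow> ennreal"
  assumes "A \<noteq> {}"
  shows "(INF a\<in>A. f a + c) = (INF a\<in>A. f a) + c"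
  using continuous_at_Inf_mono[of "\<lambda>x. x + c" "f ` A"] assms
    continuous_add[of "at_right (Inf (f ` A))", of "\<lambda>x. x" "\<lambda>x. c"]
  by (auto simp: mono_def image_comp)

lemma le_INF_add_INF_ennreal:
  fixes f :: "'a \<Rightarrow> ennreal" and g :: "'b \<Rightarrow> ennreal"
  assumes "A \<noteq> {}" "B \<noteq> {}" "\<And>a b. a \<in> A \<Longrightarrow> b \<in> B \<Longrightarrow> c \<le> f a + g b"
  shows "c \<le> (INF a\<in>A. f a) + (INF b\<in>B. g b)"
proof -
  have "c \<le> f a + (INF b\<in>B. g b)" if "a \<in> A" for a
    using INF_add_const_ennreal[OF assms(2), of g "f a"] assms(3)[OF that]
    by (simp add: add.commute) (metis (mono_tags, lifting) INF_greatest)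
  then show ?thesis
    by (simp add: INF_add_const_ennreal[OF assms(1), symmetric] INF_greatest)
qed

subsection \<open>Radon measures from contents on open sets\<close>

lemma space_borel_of: "space (borel_of Y) = topspace Y"
  unfolding borel_of_def by (rule space_measure_of) (auto dest: openin_subset)

lemma sets_borel_of: "sets (borel_of Y) = sigma_sets (topspace Y) {U. openin Y U}"
  unfolding borel_of_def by (rule sets_measure_of) (auto dest: openin_subset)

lemma openin_sets_borel_of: "openin Y U \<Longrightarrow> U \<in> sets (borel_of Y)"
  by (auto simp: sets_borel_of)

lemma closedin_sets_borel_of:
  assumes "closedin Y C" shows "C \<in> sets (borel_of Y)"
proof -
  have "space (borel_of Y) - (topspace Y - C) \<in> sets (borel_of Y)"
    using assms by (intro sets.compl_sets openin_sets_borel_of) auto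
  also have "space (borel_of Y) - (topspace Y - C) = C"
    using closedin_subset[OF assms] by (auto simp: space_borel_of)
  finally show ?thesis .
qed

lemma continuous_map_measurable_borel_of:
  assumes "continuous_map Y Z f"
  shows "f \<in> borel_of Y \<rightarrow>\<^sub>M borel_of Z"
  unfolding borel_of_def[of Z]
proof (rule measurable_measure_of)
  show "f \<in> space (borel_of Y) \<rightarrow> topspace Z"
    using assms by (auto simp: space_borel_of continuous_map_def)
  fix V assume "V \<in> {U. openin Z U}"
  then have "openin Y {x \<in> topspace Y. f x \<in> V}"
    using assms by (auto simp: continuous_map_def)
  also have "{x \<in> topspace Y. f x \<in> V} = f -` V \<inter> space (borel_of Y)"
    by (auto simp: space_borel_of)
  finally show "f -` V \<inter> space (borel_of Y) \<in> sets (borel_of Y)"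
    by (rule openin_sets_borel_of)
qed (auto dest: openin_subset)

lemma continuous_map_borel_measurable:
  assumes "continuous_map Y euclideanreal f"
  shows "f \<in> borel_measurable (borel_of Y)"
proof -
  have "borel_of euclideanreal = (borel :: real measure)"
    by (simp add: borel_of_def borel_def)
  then show ?thesis
    using continuous_map_measurable_borel_of[OF assms] by simp
qed

lemma radon_probD:
  assumes "\<mu> \<in> radon_prob Y"
  shows "prob_space \<mu>" "sets \<mu> = sets (borel_of Y)" "space \<mu> = topspace Y"
proof -
  show "sets \<mu> = sets (borel_of Y)" "prob_space \<mu>"
    using assms by (auto simp: radon_prob_def)
  then show "space \<mu> = topspace Y"
    by (auto dest: sets_eq_imp_space_eq simp: space_borel_of)
qed

text \<open>The compact sets \<open>K - G\<close> and \<open>K - H\<close> are disjoint. Removing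
  disjoint open neighbourhoods of them from \<open>K\<close> leaves two compact pieces, which cover
  \<open>K\<close> because the neighbourhoods do not meet.\<close>

lemma compactin_split_cover:
  assumes "Hausdorff_space Y" "compactin Y K" "openin Y G" "openin Y H" "K \<subseteq> G \<union> H"
  obtains K1 K2 where "compactin Y K1" "compactin Y K2" "K = K1 \<union> K2" "K1 \<subseteq> G" "K2 \<subseteq> H"
proof -
  have diff: "compactin Y (K - V)" if "openin Y V" for V
  proof -
    have "compactin Y ((topspace Y - V) \<inter> K)"
      using that assms(2) by (intro closed_Int_compactin) auto
    also have "(topspace Y - V) \<inter> K = K - V"
      using compactin_subset_topspace[OF assms(2)] by auto
    finally show ?thesis .
  qed
  have "disjnt (K - G) (K - H)" using assms(5) by (auto simp: disjnt_def)
  then obtain V W where VW: "openin Y V" "openin Y W" "K - G \<subseteq> V" "K - H \<subseteq> W" "disjnt V W"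
    using Hausdorff_space_compact_separation[OF assms(1) diff diff] assms(3,4) by metis
  show thesis
  proof (rule that[OF diff diff])
    show "openin Y V" "openin Y W" by fact+
    show "K = (K - V) \<union> (K - W)" "K - V \<subseteq> G" "K - W \<subseteq> H"
      using VW by (auto simp: disjnt_def)
  qed
qed

text \<open>
  Halmos' construction: \<open>cval\<close> regularises the content on compact sets from outside, \<open>oval\<close>
  regularises the result on open sets from inside, and \<open>outer\<close> is the induced outer measure.
  In general only \<open>oval G \<le> \<nu> G\<close> holds, since mass may escape to the boundary of \<open>G\<close>.
\<close>

locale open_content =
  fixes Y :: "'a topology" and \<nu> :: "'a set \<Rightarrow> ennreal"
  assumes Hausdorff: "Hausdorff_space Y"
    and \<nu>_empty: "\<nu> {} = 0"
    and \<nu>_mono: "openin Y U \<Longrightarrow> openin Y V \<Longrightarrow> U \<subseteq> V \<Longrightarrow> \<nu> U \<le> \<nu> V"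
    and \<nu>_subadditive: "openin Y U \<Longrightarrow> openin Y V \<Longrightarrow> \<nu> (U \<union> V) \<le> \<nu> U + \<nu> V"
    and \<nu>_superadditive: "openin Y U \<Longrightarrow> openin Y V \<Longrightarrow> disjnt U V \<Longrightarrow> \<nu> U + \<nu> V \<le> \<nu> (U \<union> V)"
begin

definition cval :: "'a set \<Rightarrow> ennreal" where
  "cval K = (INF G\<in>{G. openin Y G \<and> K \<subseteq> G}. \<nu> G)"

definition oval :: "'a set \<Rightarrow> ennreal" where
  "oval G = (SUP K\<in>{K. compactin Y K \<and> K \<subseteq> G}. cval K)"

definition outer :: "'a set \<Rightarrow> ennreal" where
  "outer A = (INF G\<in>{G. openin Y G \<and> A \<subseteq> G}. oval G)"

lemma cval_le: "openin Y G \<Longrightarrow> K \<subseteq> G \<Longrightarrow> cval K \<le> \<nu> G"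
  unfolding cval_def by (rule INF_lower) auto

lemma cval_le_oval: "compactin Y K \<Longrightarrow> K \<subseteq> G \<Longrightarrow> cval K \<le> oval G"
  unfolding oval_def by (rule SUP_upper) auto

lemma oval_le: "openin Y G \<Longrightarrow> oval G \<le> \<nu> G"
  unfolding oval_def by (rule SUP_least) (auto intro: cval_le)

lemma oval_mono: "G \<subseteq> H \<Longrightarrow> oval G \<le> oval H"
  unfolding oval_def by (rule SUP_subset_mono) auto

lemma oval_empty: "oval {} = 0"
  using oval_le[of "{}"] by (simp add: \<nu>_empty)

lemma open_supersets_ne: "A \<subseteq> topspace Y \<Longrightarrow> {G. openin Y G \<and> A \<subseteq> G} \<noteq> {}"
  by auto

lemma cval_Un_le:
  assumes "compactin Y K" "compactin Y L"
  shows "cval (K \<union> L) \<le> cval K + cval L"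
  unfolding cval_def[of K] cval_def[of L]
proof (rule le_INF_add_INF_ennreal)
  fix G H assume "G \<in> {G. openin Y G \<and> K \<subseteq> G}" "H \<in> {G. openin Y G \<and> L \<subseteq> G}"
  then have GH: "openin Y G" "openin Y H" "K \<subseteq> G" "L \<subseteq> H" by auto
  then have "cval (K \<union> L) \<le> \<nu> (G \<union> H)" by (intro cval_le) auto
  also have "\<dots> \<le> \<nu> G + \<nu> H" using GH by (intro \<nu>_subadditive)
  finally show "cval (K \<union> L) \<le> \<nu> G + \<nu> H" .
qed (use assms in \<open>auto dest: compactin_subset_topspace\<close>)

text \<open>Disjoint compact sets have disjoint open neighbourhoods \<open>V\<close> and
  \<open>W\<close>; these cut every open superset of the union into two disjoint open pieces, to
  which superadditivity of the content applies.\<close>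

lemma cval_Un_ge:
  assumes "compactin Y K" "compactin Y L" "disjnt K L"
  shows "cval K + cval L \<le> cval (K \<union> L)"
  unfolding cval_def[of "K \<union> L"]
proof (rule INF_greatest)
  fix G assume "G \<in> {G. openin Y G \<and> K \<union> L \<subseteq> G}"
  then have G: "openin Y G" "K \<subseteq> G" "L \<subseteq> G" by auto
  obtain V W where VW: "openin Y V" "openin Y W" "K \<subseteq> V" "L \<subseteq> W" "disjnt V W"
    using Hausdorff_space_compact_separation[OF Hausdorff assms] by metis
  have "cval K + cval L \<le> \<nu> (G \<inter> V) + \<nu> (G \<inter> W)"
    using G VW by (intro add_mono cval_le) auto
  also have "\<dots> \<le> \<nu> (G \<inter> V \<union> G \<inter> W)"
    using G VW by (intro \<nu>_superadditive) (auto simp: disjnt_def)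
  also have "\<dots> \<le> \<nu> G"
    using G VW by (intro \<nu>_mono) auto
  finally show "cval K + cval L \<le> \<nu> G" .
qed

lemma oval_Un_le:
  assumes "openin Y G" "openin Y H"
  shows "oval (G \<union> H) \<le> oval G + oval H"
  unfolding oval_def[of "G \<union> H"]
proof (rule SUP_least)
  fix K assume "K \<in> {K. compactin Y K \<and> K \<subseteq> G \<union> H}"
  then obtain K1 K2 where K: "compactin Y K1" "compactin Y K2" "K = K1 \<union> K2" "K1 \<subseteq> G" "K2 \<subseteq> H"
    using compactin_split_cover[OF Hausdorff _ assms] by blast
  then have "cval K \<le> cval K1 + cval K2" by (auto intro: cval_Un_le)
  also have "\<dots> \<le> oval G + oval H" using K by (intro add_mono cval_le_oval)
  finally show "cval K \<le> oval G + oval H" .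
qed

text \<open>Countable subadditivity comes from compactness: a compact subset of the union already
  lies in a finite partial union, so the finite subadditivity of the content suffices.\<close>

lemma oval_UN_le:
  fixes G :: "nat \<Rightarrow> 'a set"
  assumes G: "\<And>i. openin Y (G i)"
  shows "oval (\<Union>i. G i) \<le> (\<Sum>i. oval (G i))"
proof -
  have fin: "oval (\<Union>i<n. G i) \<le> (\<Sum>i<n. oval (G i))" for n
  proof (induction n)
    case (Suc n)
    have "oval (\<Union>i<Suc n. G i) = oval ((\<Union>i<n. G i) \<union> G n)"
      by (simp add: lessThan_Suc Un_commute)
    also have "\<dots> \<le> oval (\<Union>i<n. G i) + oval (G n)"
      using G by (intro oval_Un_le) auto
    finally show ?case using Suc by (auto intro: order_trans add_right_mono)
  qed (simp add: oval_empty)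
  show ?thesis
    unfolding oval_def[of "\<Union>i. G i"]
  proof (rule SUP_least)
    fix K assume "K \<in> {K. compactin Y K \<and> K \<subseteq> (\<Union>i. G i)}"
    then have K: "compactin Y K" "K \<subseteq> \<Union>(range G)" by auto
    moreover have "\<And>U. U \<in> range G \<Longrightarrow> openin Y U" using G by auto
    ultimately obtain \<F> where \<F>: "finite \<F>" "\<F> \<subseteq> range G" "K \<subseteq> \<Union>\<F>"
      using compactinD[OF K(1), of "range G"] by metis
    then obtain S where S: "finite S" "\<F> = G ` S" by (meson finite_subset_image)
    then obtain n where "S \<subseteq> {..<n}"
      using finite_nat_iff_bounded by auto
    then have "K \<subseteq> (\<Union>i<n. G i)" using S \<F> by blast
    then have "cval K \<le> oval (\<Union>i<n. G i)" using K by (intro cval_le_oval)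
    also have "\<dots> \<le> (\<Sum>i. oval (G i))"
      using fin[of n] by (rule order_trans) (auto intro: sum_le_suminf)
    finally show "cval K \<le> (\<Sum>i. oval (G i))" .
  qed
qed

lemma outer_open: "openin Y G \<Longrightarrow> outer G = oval G"
  unfolding outer_def by (rule antisym) (auto intro!: INF_lower2[of G] INF_greatest oval_mono)

lemma outer_mono: "A \<subseteq> B \<Longrightarrow> outer A \<le> outer B"
  unfolding outer_def by (rule INF_superset_mono) auto

lemma outer_le_oval: "openin Y G \<Longrightarrow> A \<subseteq> G \<Longrightarrow> outer A \<le> oval G"
  unfolding outer_def by (rule INF_lower) auto

lemma outer_UN_le:
  fixes A :: "nat \<Rightarrow> 'a set"
  shows "outer (\<Union>i. A i) \<le> (\<Sum>i. outer (A i))"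
proof (rule ennreal_le_epsilon)
  fix e :: real assume fin: "(\<Sum>i. outer (A i)) < top" and e: "0 < e"
  \<comment> \<open>The errors sum to \<open>e\<close>. Finiteness of \<open>outer (A i)\<close>
    makes the added error a strict increase, and it excludes sets that stick out of the space, where
    the infimum is over the empty family and equals \<open>top\<close>.\<close>
  have "\<exists>G. openin Y G \<and> A i \<subseteq> G \<and> oval G < outer (A i) + ennreal (e * (1/2) ^ Suc i)" for i
  proof -
    have "outer (A i) < top"
      using ennreal_suminf_lessD[OF fin] by simp
    then have "outer (A i) < outer (A i) + ennreal (e * (1/2) ^ Suc i)"
      using e by (simp add: ennreal_add_left_cancel_less)
    then show ?thesis
      unfolding outer_def[of "A i"] by (subst (asm) (1) INF_less_iff) auto
  qed
  then obtain G where G: "\<And>i. openin Y (G i)" "\<And>i. A i \<subseteq> G i"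
      "\<And>i. oval (G i) < outer (A i) + ennreal (e * (1/2) ^ Suc i)"
    by metis
  have "outer (\<Union>i. A i) \<le> oval (\<Union>i. G i)"
    using G by (intro outer_le_oval) auto
  also have "\<dots> \<le> (\<Sum>i. oval (G i))" using G by (intro oval_UN_le)
  also have "\<dots> \<le> (\<Sum>i. outer (A i) + ennreal (e * (1/2) ^ Suc i))"
    using G(3) by (intro suminf_le) (auto intro: less_imp_le)
  also have "\<dots> = (\<Sum>i. outer (A i)) + (\<Sum>i. ennreal (e * (1/2) ^ Suc i))"
    by (rule suminf_add[symmetric]) auto
  also have "(\<Sum>i. ennreal (e * (1/2) ^ Suc i)) = ennreal e"
    using e sums_mult[OF power_half_series, of e] by (intro suminf_ennreal_eq) auto
  finally show "outer (\<Union>i. A i) \<le> (\<Sum>i. outer (A i)) + ennreal e" .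
qed

lemma outer_measure_space_outer: "outer_measure_space (Pow (topspace Y)) outer"
  unfolding outer_measure_space_def positive_def increasing_def countably_subadditive_def
  using outer_open[of "{}"] by (auto simp: oval_empty intro: outer_mono outer_UN_le)

text \<open>Caratheodory's condition for an open \<open>U\<close>. Given an open \<open>G\<close>
  around \<open>A\<close>, exhaust \<open>G \<inter> U\<close> by compact sets \<open>K\<close>,
  then exhaust the open set \<open>G - K\<close>, which contains \<open>A - U\<close>, by compact
  sets \<open>L\<close>. Both lie in \<open>G\<close> and are disjoint, so
  \<open>cval K + cval L\<close> is at most \<open>oval G\<close>.\<close>

lemma open_in_lambda_system:
  assumes U: "openin Y U"
  shows "U \<in> lambda_system (topspace Y) (Pow (topspace Y)) outer"
proof -
  have "outer (A \<inter> U) + outer (A - U) = outer A" if A: "A \<subseteq> topspace Y" for A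
  proof (rule antisym)
    \<comment> \<open>Binary subadditivity is read off from the countable version by padding with
      empty sets.\<close>
    let ?B = "\<lambda>i::nat. if i = 0 then A \<inter> U else if i = 1 then A - U else {}"
    have "outer A \<le> outer (\<Union>i. ?B i)" by (rule outer_mono) (auto split: if_splits)
    also have "\<dots> \<le> (\<Sum>i. outer (?B i))" by (rule outer_UN_le)
    also have "\<dots> = (\<Sum>i\<in>{0,1}. outer (?B i))"
      using outer_open[of "{}"] by (intro suminf_finite) (auto simp: oval_empty)
    finally show "outer A \<le> outer (A \<inter> U) + outer (A - U)" by simp
  next
    show "outer (A \<inter> U) + outer (A - U) \<le> outer A"
      unfolding outer_def[of A]
    proof (rule INF_greatest)
      fix G assume "G \<in> {G. openin Y G \<and> A \<subseteq> G}"
      then have G: "openin Y G" "A \<subseteq> G" by auto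
      \<comment> \<open>The outer supremum over \<open>K\<close> is taken with \<open>A - U\<close>
        fixed; the choice of \<open>L\<close> depends on \<open>K\<close>.\<close>
      have "oval (G \<inter> U) + outer (A - U) \<le> oval G"
        unfolding oval_def[of "G \<inter> U"]
      proof (subst ennreal_SUP_add_left[symmetric])
        show "{K. compactin Y K \<and> K \<subseteq> G \<inter> U} \<noteq> {}" by (auto intro: exI[of _ "{}"])
        show "(SUP K\<in>{K. compactin Y K \<and> K \<subseteq> G \<inter> U}. cval K + outer (A - U)) \<le> oval G"
        proof (rule SUP_least)
          fix K assume "K \<in> {K. compactin Y K \<and> K \<subseteq> G \<inter> U}"
          then have K: "compactin Y K" "K \<subseteq> G" "K \<subseteq> U" by auto
          have GK: "openin Y (G - K)"
            using G K compactin_imp_closedin[OF Hausdorff] by (intro openin_diff) auto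
          have "cval K + outer (A - U) \<le> cval K + oval (G - K)"
            using GK G K by (intro add_left_mono outer_le_oval) auto
          also have "\<dots> \<le> oval G"
            unfolding oval_def[of "G - K"]
          proof (subst ennreal_SUP_add_right)
            show "{L. compactin Y L \<and> L \<subseteq> G - K} \<noteq> {}" by (auto intro: exI[of _ "{}"])
            show "(SUP L\<in>{L. compactin Y L \<and> L \<subseteq> G - K}. cval K + cval L) \<le> oval G"
            proof (rule SUP_least)
              fix L assume "L \<in> {L. compactin Y L \<and> L \<subseteq> G - K}"
              then have L: "compactin Y L" "L \<subseteq> G - K" by auto
              then have "cval K + cval L \<le> cval (K \<union> L)"
                using K by (intro cval_Un_ge) (auto simp: disjnt_def)
              also have "\<dots> \<le> oval G"
                using K L by (intro cval_le_oval compactin_Un) auto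
              finally show "cval K + cval L \<le> oval G" .
            qed
          qed
          finally show "cval K + outer (A - U) \<le> oval G" .
        qed
      qed
      moreover have "outer (A \<inter> U) \<le> oval (G \<inter> U)"
        using G U by (intro outer_le_oval) auto
      ultimately show "outer (A \<inter> U) + outer (A - U) \<le> oval G"
        by (meson add_right_mono order_trans)
    qed
  qed
  moreover have "algebra (topspace Y) (Pow (topspace Y))"
    by (rule algebra_Pow)
  ultimately show ?thesis
    using openin_subset[OF U] by (auto simp: algebra.lambda_system_eq)
qed

text \<open>\<open>measure_of\<close> defaults to the zero measure when \<open>outer\<close> is not
  a measure on the generated sigma-algebra; that it is one is established in
  \<open>emeasure_radon_extension\<close>.\<close>

definition radon_extension :: "'a measure" where
  "radon_extension = measure_of (topspace Y) {U. openin Y U} outer"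

lemma sets_radon_extension: "sets radon_extension = sets (borel_of Y)"
  unfolding radon_extension_def sets_borel_of
  by (rule sets_measure_of) (auto dest: openin_subset)

lemma space_radon_extension: "space radon_extension = topspace Y"
  using sets_eq_imp_space_eq[OF sets_radon_extension] by (simp add: space_borel_of)

text \<open>The sets satisfying Caratheodory's condition form a sigma-algebra on which
  \<open>outer\<close> is countably additive. It contains the open sets and hence all Borel
  sets.\<close>

lemma emeasure_radon_extension:
  assumes "A \<in> sets (borel_of Y)"
  shows "emeasure radon_extension A = outer A"
proof -
  let ?L = "lambda_system (topspace Y) (Pow (topspace Y)) outer"
  have "measure_space (topspace Y) ?L outer"
    by (rule sigma_algebra.caratheodory_lemma[OF sigma_algebra_Pow outer_measure_space_outer])
  then have L: "sigma_algebra (topspace Y) ?L" "positive ?L outer" "countably_additive ?L outer"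
    by (auto simp: measure_space_def)
  have sub: "sigma_sets (topspace Y) {U. openin Y U} \<subseteq> ?L"
    using L(1) open_in_lambda_system by (intro sigma_algebra.sigma_sets_subset) auto
  show ?thesis
  proof (rule emeasure_measure_of[OF radon_extension_def])
    show "positive (sets radon_extension) outer" "countably_additive (sets radon_extension) outer"
      using L(2,3) sub unfolding sets_radon_extension sets_borel_of
      by (auto simp: positive_def countably_additive_def)
  qed (use assms in \<open>auto simp: sets_radon_extension dest: openin_subset\<close>)
qed

lemma emeasure_radon_extension_le: "openin Y G \<Longrightarrow> emeasure radon_extension G \<le> \<nu> G"
  by (simp add: emeasure_radon_extension openin_sets_borel_of outer_open oval_le)

text \<open>The tightness hypothesis bounds \<open>cval K\<close> from below by
  \<open>1 - e\<close>, and \<open>cval K \<le> outer K\<close> because \<open>K\<close> competes in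
  \<open>oval G\<close> for every open \<open>G\<close> around it; so no mass is lost. Inner
  regularity then follows from outer regularity of the complement together with these compact
  sets.\<close>

lemma radon_extension_radon_prob:
  assumes total: "\<nu> (topspace Y) \<le> 1"
    and tight: "\<And>e. 0 < e \<Longrightarrow> \<exists>K. compactin Y K \<and> (\<forall>G. openin Y G \<longrightarrow> K \<subseteq> G \<longrightarrow> 1 \<le> \<nu> G + ennreal e)"
  shows "radon_extension \<in> radon_prob Y"
proof -
  let ?\<mu> = radon_extension
  have compact_mass: "\<exists>K. compactin Y K \<and> 1 \<le> emeasure ?\<mu> K + ennreal e" if "0 < e" for e
  proof -
    obtain K where K: "compactin Y K" "\<And>G. openin Y G \<Longrightarrow> K \<subseteq> G \<Longrightarrow> 1 \<le> \<nu> G + ennreal e"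
      using tight[OF \<open>0 < e\<close>] by auto
    have "1 \<le> cval K + ennreal e"
      unfolding cval_def using K open_supersets_ne[OF compactin_subset_topspace[OF K(1)]]
      by (subst INF_add_const_ennreal[symmetric]) (auto intro!: INF_greatest)
    also have "cval K \<le> outer K"
      unfolding outer_def using K by (auto intro!: INF_greatest cval_le_oval)
    also have "outer K = emeasure ?\<mu> K"
      using K compactin_imp_closedin[OF Hausdorff]
      by (simp add: emeasure_radon_extension closedin_sets_borel_of)
    finally show ?thesis using K(1) by (auto intro: add_right_mono)
  qed
  have "emeasure ?\<mu> (space ?\<mu>) = 1"
  proof (rule antisym)
    show "emeasure ?\<mu> (space ?\<mu>) \<le> 1"
      using emeasure_radon_extension_le[of "topspace Y"] total by (simp add: space_radon_extension)
    show "1 \<le> emeasure ?\<mu> (space ?\<mu>)"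
    proof (rule ennreal_le_epsilon)
      fix e :: real assume "0 < e"
      then obtain K where "1 \<le> emeasure ?\<mu> K + ennreal e" using compact_mass by blast
      also have "\<dots> \<le> emeasure ?\<mu> (space ?\<mu>) + ennreal e"
        by (intro add_right_mono emeasure_space)
      finally show "1 \<le> emeasure ?\<mu> (space ?\<mu>) + ennreal e" .
    qed
  qed
  then interpret prob_space ?\<mu> by (rule prob_spaceI)
  have "\<exists>K. compactin Y K \<and> K \<subseteq> B \<and> measure ?\<mu> (B - K) < e" if B: "B \<in> sets ?\<mu>" and e: "0 < e" for B e
  proof -
    have Bc: "space ?\<mu> - B \<in> sets ?\<mu>" using B by auto
    \<comment> \<open>An open \<open>G\<close> around the complement of \<open>B\<close> with excess
      at most \<open>e / 3\<close>, and a compact \<open>K\<close> missing at most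
      \<open>e / 3\<close>: removing \<open>G\<close> from \<open>K\<close> leaves a compact subset
      of \<open>B\<close> that misses at most \<open>2 * e / 3 < e\<close>.\<close>
    have "outer (space ?\<mu> - B) < outer (space ?\<mu> - B) + ennreal (e / 3)"
      using e Bc emeasure_finite[of "space ?\<mu> - B"]
      by (simp add: ennreal_add_left_cancel_less emeasure_radon_extension sets_radon_extension less_top)
    then obtain G where G: "openin Y G" "space ?\<mu> - B \<subseteq> G"
        "oval G < outer (space ?\<mu> - B) + ennreal (e / 3)"
      unfolding outer_def[of "space ?\<mu> - B"] by (subst (asm) (1) INF_less_iff) auto
    have Gs: "G \<in> sets ?\<mu>" using G by (auto simp: sets_radon_extension openin_sets_borel_of)
    have "emeasure ?\<mu> G \<le> emeasure ?\<mu> (space ?\<mu> - B) + ennreal (e / 3)"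
      using G Bc Gs by (simp add: emeasure_radon_extension sets_radon_extension outer_open)
    then have mG: "prob G \<le> prob (space ?\<mu> - B) + e / 3"
      using e by (simp add: emeasure_eq_measure flip: ennreal_plus)
    obtain K where K: "compactin Y K" "1 \<le> emeasure ?\<mu> K + ennreal (e / 3)"
      using compact_mass[of "e/3"] e by auto
    have Ks: "K \<in> sets ?\<mu>"
      using K compactin_imp_closedin[OF Hausdorff] by (simp add: sets_radon_extension closedin_sets_borel_of)
    have mK: "prob (space ?\<mu> - K) \<le> e / 3"
      using K(2) e Ks by (simp add: emeasure_eq_measure prob_compl flip: ennreal_plus ennreal_1)
    let ?K = "(topspace Y - G) \<inter> K"
    have "compactin Y ?K" using G K by (intro closed_Int_compactin) auto
    moreover have sub: "?K \<subseteq> B" using G(2) by (auto simp: space_radon_extension)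
    moreover have "measure ?\<mu> (B - ?K) < e"
    proof -
      have "B - ?K \<subseteq> (G - (space ?\<mu> - B)) \<union> (space ?\<mu> - K)"
        using sets.sets_into_space[OF B] by (auto simp: space_radon_extension)
      then have "prob (B - ?K) \<le> prob ((G - (space ?\<mu> - B)) \<union> (space ?\<mu> - K))"
        using Gs Bc Ks by (intro finite_measure_mono) auto
      also have "\<dots> \<le> prob (G - (space ?\<mu> - B)) + prob (space ?\<mu> - K)"
        using Gs Bc Ks by (intro measure_Un_le) auto
      also have "prob (G - (space ?\<mu> - B)) = prob G - prob (space ?\<mu> - B)"
        using Gs Bc G(2) by (intro finite_measure_Diff) auto
      finally show ?thesis using mG mK e by simp
    qed
    ultimately show ?thesis by blast
  qed
  then show ?thesis
    unfolding radon_prob_def using prob_space_axioms sets_radon_extension by blast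
qed

end

subsection \<open>Integrals of lower semicontinuous functions\<close>

lemma Liminf_add_le_ennreal:
  fixes f g :: "'a \<Rightarrow> ennreal"
  shows "Liminf F f + Liminf F g \<le> Liminf F (\<lambda>x. f x + g x)"
  unfolding Liminf_def[of F f] Liminf_def[of F g]
proof (rule SUP_add_SUP_le_ennreal)
  fix P Q assume "P \<in> {P. eventually P F}" "Q \<in> {P. eventually P F}"
  then have "eventually (\<lambda>x. P x \<and> Q x) F" by (auto intro: eventually_conj)
  then show "(INF x\<in>Collect P. f x) + (INF x\<in>Collect Q. g x) \<le> Liminf F (\<lambda>x. f x + g x)"
    by (intro Liminf_bounded) (auto elim!: eventually_mono intro!: add_mono INF_lower)
qed (auto intro!: exI[of _ "\<lambda>_. True"])

lemma Liminf_sum_le_ennreal: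
  fixes f :: "'b \<Rightarrow> 'a \<Rightarrow> ennreal"
  assumes "finite A"
  shows "(\<Sum>k\<in>A. Liminf F (f k)) \<le> Liminf F (\<lambda>x. \<Sum>k\<in>A. f k x)"
  using assms
proof (induction A rule: finite_induct)
  case (insert k A)
  have "Liminf F (f k) + (\<Sum>k\<in>A. Liminf F (f k)) \<le> Liminf F (f k) + Liminf F (\<lambda>x. \<Sum>k\<in>A. f k x)"
    using insert by (intro add_left_mono)
  also have "\<dots> \<le> Liminf F (\<lambda>x. f k x + (\<Sum>k\<in>A. f k x))" by (rule Liminf_add_le_ennreal)
  finally show ?case using insert by simp
qed simp

lemma Liminf_cmult_le_ennreal:
  fixes f :: "'a \<Rightarrow> ennreal"
  shows "c * Liminf F f \<le> Liminf F (\<lambda>x. c * f x)"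
  unfolding Liminf_def[of F f] SUP_mult_left_ennreal
proof (rule SUP_least)
  fix P assume "P \<in> {P. eventually P F}"
  then show "c * (INF x\<in>Collect P. f x) \<le> Liminf F (\<lambda>x. c * f x)"
    by (intro Liminf_bounded) (auto elim!: eventually_mono intro!: mult_left_mono INF_lower)
qed

text \<open>
  A discrete layer-cake approximation from below. A finite sum replaces the integral over levels
  because Fatou's lemma is not available for nets.
\<close>

definition staircase :: "nat \<Rightarrow> ennreal \<Rightarrow> ennreal" where
  "staircase n x = ennreal (1 / real n) * (\<Sum>k=1..n*n. indicator {ennreal (real k / real n)<..} x)"

lemma staircase_eq_card:
  "staircase n x = ennreal (real (card {k\<in>{1..n*n}. ennreal (real k / real n) < x}) / real n)"
proof -
  have "(\<Sum>k=1..n*n. indicator {ennreal (real k / real n)<..} x) =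
      (\<Sum>k=1..n*n. if ennreal (real k / real n) < x then 1 else (0::ennreal))"
    by (intro sum.cong) (auto simp: indicator_def)
  also have "\<dots> = of_nat (card {k\<in>{1..n*n}. ennreal (real k / real n) < x})"
    by (simp flip: sum.inter_filter)
  finally show ?thesis
    unfolding staircase_def by (simp add: ennreal_of_nat_eq_real_of_nat flip: ennreal_mult)
qed

text \<open>For a finite \<open>x = r\<close>, a level \<open>k / n\<close> below \<open>r\<close>
  forces \<open>k \<le> n * r\<close>, so at most \<open>n * r\<close> steps of height
  \<open>1 / n\<close> are counted.\<close>

lemma staircase_le: "staircase n x \<le> x"
proof (cases x)
  case (real r)
  have "{k\<in>{1..n*n}. ennreal (real k / real n) < x} \<subseteq> {1..nat \<lfloor>real n * r\<rfloor>}"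
  proof
    fix k assume k: "k \<in> {k\<in>{1..n*n}. ennreal (real k / real n) < x}"
    then have "0 < n" by (cases n) auto
    moreover have "real k / real n < r"
      using k real by (simp add: ennreal_less_iff)
    ultimately have "real k \<le> real n * r" by (simp add: field_simps)
    then show "k \<in> {1..nat \<lfloor>real n * r\<rfloor>}" using k by (auto simp: le_nat_floor)
  qed
  then have "card {k\<in>{1..n*n}. ennreal (real k / real n) < x} \<le> nat \<lfloor>real n * r\<rfloor>"
    using card_mono[of "{1..nat \<lfloor>real n * r\<rfloor>}"] by fastforce
  then have "real (card {k\<in>{1..n*n}. ennreal (real k / real n) < x}) \<le> real n * r"
    using real of_nat_floor[of "real n * r"] by (auto intro: order_trans of_nat_mono)
  then show ?thesis
    unfolding staircase_eq_card using real
    by (cases "n = 0") (auto intro!: ennreal_leI simp: field_simps)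
qed simp

lemma eventually_le_staircase:
  assumes "ennreal c < x" "0 \<le> c"
  shows "eventually (\<lambda>n. ennreal c \<le> staircase n x) sequentially"
proof -
  \<comment> \<open>A finite level above \<open>c\<close>; for infinite \<open>x\<close> the value
    \<open>c + 1\<close> serves.\<close>
  obtain r where r: "c < r" "ennreal r \<le> x"
    using assms by (cases x) (auto simp: ennreal_less_iff intro: that[of "c + 1"])
  \<comment> \<open>The first bound makes the mesh finer than the gap \<open>r - c\<close>, so that
    rounding \<open>n * c\<close> up stays below \<open>n * r\<close>. The second keeps the rounded
    index within the cutoff \<open>n * n\<close>.\<close>
  obtain N where N: "1 / (r - c) < real N" "c + 1 \<le> real N"
    using reals_Archimedean2[of "max (1 / (r - c)) (c + 1)"] by auto
  show ?thesis
    using eventually_ge_at_top[of N]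
  proof eventually_elim
    case (elim n)
    have n: "1 / (r - c) < real n" "c + 1 \<le> real n" using elim N by linarith+
    let ?m = "nat \<lceil>real n * c\<rceil>"
    have n0: "0 < real n" using n assms by linarith
    have m: "real n * c \<le> real ?m" "real ?m < real n * c + 1"
      using assms n0 ceiling_correct[of "real n * c"] by (auto simp: real_nat_ceiling_ge)
    have "real n * c + 1 \<le> real n * real n"
    proof -
      have "real n * (c + 1) \<le> real n * real n" using n n0 by (intro mult_left_mono) auto
      moreover have "1 \<le> real n" using n assms by linarith
      ultimately show ?thesis by (simp add: algebra_simps)
    qed
    then have mn: "?m \<le> n * n" using m(2) by (simp flip: of_nat_le_iff[where 'a=real])
    have "real n * c + 1 < real n * r"
      using n(1) r n0 by (simp add: field_simps)
    then have lt: "real k / real n < r" if "k \<le> ?m" for k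
      using that m(2) n0 by (simp add: field_simps)
    have "{1..?m} \<subseteq> {k\<in>{1..n*n}. ennreal (real k / real n) < x}"
    proof
      fix k assume k: "k \<in> {1..?m}"
      then have "ennreal (real k / real n) < ennreal r"
        using lt[of k] r(1) assms(2) by (intro ennreal_lessI) auto
      then show "k \<in> {k\<in>{1..n*n}. ennreal (real k / real n) < x}"
        using le_trans[OF _ mn, of k] k r(2) by (auto intro: less_le_trans)
    qed
    then have "card {1..?m} \<le> card {k\<in>{1..n*n}. ennreal (real k / real n) < x}"
      by (intro card_mono) auto
    then have "real ?m \<le> real (card {k\<in>{1..n*n}. ennreal (real k / real n) < x})" by simp
    then have "real n * c \<le> real (card {k\<in>{1..n*n}. ennreal (real k / real n) < x})"
      using m(1) by linarith
    then show ?case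
      unfolding staircase_eq_card using n0 by (intro ennreal_leI) (simp add: field_simps)
  qed
qed

text \<open>The staircases are not monotone in \<open>n\<close>, so the passage to the limit goes
  through Fatou's lemma, for which this one-sided bound suffices.\<close>

lemma le_liminf_staircase: "x \<le> liminf (\<lambda>n. staircase n x)"
proof (rule dense_le)
  fix y assume y: "y < x"
  then obtain c where "y = ennreal c" "0 \<le> c" by (cases y) auto
  then show "y \<le> liminf (\<lambda>n. staircase n x)"
    using eventually_le_staircase[of c x] y by (intro Liminf_bounded) auto
qed

lemma nn_integral_staircase:
  assumes [measurable]: "g \<in> borel_measurable M"
  shows "(\<integral>\<^sup>+x. staircase n (g x) \<partial>M) =
    ennreal (1 / real n) * (\<Sum>k=1..n*n. emeasure M {x\<in>space M. ennreal (real k / real n) < g x})"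
proof -
  have ind: "(\<integral>\<^sup>+x. indicator {a<..} (g x) \<partial>M) = emeasure M {x\<in>space M. a < g x}" for a
  proof -
    have "(\<integral>\<^sup>+x. indicator {a<..} (g x) \<partial>M) = (\<integral>\<^sup>+x. indicator {x\<in>space M. a < g x} x \<partial>M)"
      by (intro nn_integral_cong) (auto simp: indicator_def)
    also have "\<dots> = emeasure M {x\<in>space M. a < g x}" by (rule nn_integral_indicator) measurable
    finally show ?thesis .
  qed
  show ?thesis
    unfolding staircase_def ind[symmetric]
    by (subst nn_integral_cmult, simp) (subst nn_integral_sum, auto)
qed

lemma measurable_staircase[measurable]: "staircase n \<in> borel_measurable borel"
  unfolding staircase_def by measurable

text \<open>For fixed \<open>n\<close> the integral of the staircase is a finite nonnegative
  combination of measures of superlevel sets, and \<open>Liminf\<close> is superadditive along any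
  filter. The limit in \<open>n\<close> involves only the single measure \<open>\<mu>\<close>, where
  Fatou's lemma for sequences applies.\<close>

lemma nn_integral_le_Liminf_superlevel:
  fixes M :: "'i \<Rightarrow> 'a measure"
  assumes [measurable]: "g \<in> borel_measurable \<mu>"
    and M: "eventually (\<lambda>i. g \<in> borel_measurable (M i)) F"
    and le: "\<And>a. 0 \<le> a \<Longrightarrow> emeasure \<mu> {x\<in>space \<mu>. ennreal a < g x} \<le>
      Liminf F (\<lambda>i. emeasure (M i) {x\<in>space (M i). ennreal a < g x})"
  shows "(\<integral>\<^sup>+x. g x \<partial>\<mu>) \<le> Liminf F (\<lambda>i. \<integral>\<^sup>+x. g x \<partial>(M i))"
proof -
  have stair: "(\<integral>\<^sup>+x. staircase n (g x) \<partial>\<mu>) \<le> Liminf F (\<lambda>i. \<integral>\<^sup>+x. g x \<partial>(M i))" for n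
  proof -
    let ?E = "\<lambda>k i. emeasure (M i) {x\<in>space (M i). ennreal (real k / real n) < g x}"
    have "(\<integral>\<^sup>+x. staircase n (g x) \<partial>\<mu>) \<le> ennreal (1 / real n) * (\<Sum>k=1..n*n. Liminf F (?E k))"
      by (subst nn_integral_staircase, simp) (intro mult_left_mono sum_mono le, auto)
    also have "\<dots> \<le> ennreal (1 / real n) * Liminf F (\<lambda>i. \<Sum>k=1..n*n. ?E k i)"
      by (intro mult_left_mono Liminf_sum_le_ennreal) auto
    also have "\<dots> \<le> Liminf F (\<lambda>i. ennreal (1 / real n) * (\<Sum>k=1..n*n. ?E k i))"
      by (rule Liminf_cmult_le_ennreal)
    also have "\<dots> \<le> Liminf F (\<lambda>i. \<integral>\<^sup>+x. g x \<partial>(M i))"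
      using M
    proof (intro Liminf_mono, eventually_elim)
      case (elim i)
      then show ?case
        by (subst nn_integral_staircase[symmetric]) (auto intro: nn_integral_mono staircase_le)
    qed
    finally show ?thesis .
  qed
  have "(\<integral>\<^sup>+x. g x \<partial>\<mu>) \<le> (\<integral>\<^sup>+x. liminf (\<lambda>n. staircase n (g x)) \<partial>\<mu>)"
    by (intro nn_integral_mono le_liminf_staircase)
  also have "\<dots> \<le> liminf (\<lambda>n. \<integral>\<^sup>+x. staircase n (g x) \<partial>\<mu>)"
    by (rule nn_integral_liminf) measurable
  also have "\<dots> \<le> Liminf F (\<lambda>i. \<integral>\<^sup>+x. g x \<partial>(M i))"
    using stair by (intro Liminf_le) auto
  finally show ?thesis .
qed

section \<open>Weak convergence from lower bounds on open sets\<close>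

lemma C_b_integrable:
  assumes "\<mu> \<in> radon_prob Y" "f \<in> C_b Y"
  shows "integrable \<mu> f"
proof -
  interpret prob_space \<mu> using assms by (simp add: radon_probD)
  obtain B where "\<And>x. x \<in> topspace Y \<Longrightarrow> \<bar>f x\<bar> \<le> B"
    using assms(2) by (auto simp: C_b_def bounded_iff)
  moreover have "f \<in> borel_measurable \<mu>"
    using assms continuous_map_borel_measurable[of Y f] measurable_cong_sets[OF radon_probD(2)[OF assms(1)] refl]
    by (auto simp: C_b_def)
  ultimately show ?thesis
    using radon_probD(3)[OF assms(1)] by (intro integrable_const_bound[of _ B]) auto
qed

lemma tendsto_integral_if_open_le_Liminf:
  fixes M :: "'i \<Rightarrow> 'a measure"
  assumes \<mu>: "\<mu> \<in> radon_prob Y" and M: "eventually (\<lambda>i. M i \<in> radon_prob Y) F"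
    and le: "\<And>G. openin Y G \<Longrightarrow> emeasure \<mu> G \<le> Liminf F (\<lambda>i. emeasure (M i) G)"
    and f: "f \<in> C_b Y"
  shows "((\<lambda>i. integral\<^sup>L (M i) f) \<longlongrightarrow> integral\<^sup>L \<mu> f) F"
proof -
  \<comment> \<open>Superlevel sets of a nonnegative continuous function are open, so the hypothesis
    on open sets bounds its integral from below.\<close>
  have lower: "eventually (\<lambda>i. a < integral\<^sup>L (M i) h) F"
    if h: "h \<in> C_b Y" "\<And>x. x \<in> topspace Y \<Longrightarrow> 0 \<le> h x" and a: "a < integral\<^sup>L \<mu> h" for h a
  proof -
    have hm: "h \<in> borel_measurable N" "(\<integral>\<^sup>+x. ennreal (h x) \<partial>N) = ennreal (integral\<^sup>L N h)" "0 \<le> integral\<^sup>L N h"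
      if N: "N \<in> radon_prob Y" for N
    proof -
      have I: "integrable N h" by (rule C_b_integrable[OF N h(1)])
      then show "h \<in> borel_measurable N" by auto
      have nn: "AE x in N. 0 \<le> h x" using h(2) radon_probD(3)[OF N] by auto
      show "(\<integral>\<^sup>+x. ennreal (h x) \<partial>N) = ennreal (integral\<^sup>L N h)"
        by (rule nn_integral_eq_integral[OF I nn])
      show "0 \<le> integral\<^sup>L N h" using nn by (rule integral_nonneg_AE)
    qed
    have "emeasure \<mu> {x\<in>space \<mu>. ennreal c < ennreal (h x)} \<le>
        Liminf F (\<lambda>i. emeasure (M i) {x\<in>space (M i). ennreal c < ennreal (h x)})" if "0 \<le> c" for c
    proof -
      have eq: "{x\<in>space N. ennreal c < ennreal (h x)} = {x\<in>topspace Y. h x \<in> {c<..}}"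
        if "N \<in> radon_prob Y" for N
        using radon_probD(3)[OF that] h(2) \<open>0 \<le> c\<close> by (auto simp: ennreal_less_iff)
      have "openin Y {x\<in>topspace Y. h x \<in> {c<..}}"
        using h(1) by (intro openin_continuous_map_preimage) (auto simp: C_b_def)
      note le[OF this]
      also have "Liminf F (\<lambda>i. emeasure (M i) {x\<in>topspace Y. h x \<in> {c<..}}) =
          Liminf F (\<lambda>i. emeasure (M i) {x\<in>space (M i). ennreal c < ennreal (h x)})"
        using M by (intro Liminf_eq, eventually_elim) (simp add: eq)
      finally show ?thesis using eq[OF \<mu>] by simp
    qed
    then have "(\<integral>\<^sup>+x. ennreal (h x) \<partial>\<mu>) \<le> Liminf F (\<lambda>i. \<integral>\<^sup>+x. ennreal (h x) \<partial>(M i))"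
      using hm(1)[OF \<mu>] M by (intro nn_integral_le_Liminf_superlevel) (auto elim!: eventually_mono dest: hm(1))
    also have "\<dots> = Liminf F (\<lambda>i. ennreal (integral\<^sup>L (M i) h))"
      using M by (intro Liminf_eq, eventually_elim) (simp add: hm)
    finally have L: "ennreal (integral\<^sup>L \<mu> h) \<le> Liminf F (\<lambda>i. ennreal (integral\<^sup>L (M i) h))"
      by (simp add: hm(2)[OF \<mu>])
    show ?thesis
    \<comment> \<open>Negative thresholds are treated apart because \<open>ennreal\<close> truncates
      them to 0.\<close>
    proof (cases "a < 0")
      case True
      show ?thesis using M by eventually_elim (use True hm(3) in fastforce)
    next
      case False
      then have "ennreal a < Liminf F (\<lambda>i. ennreal (integral\<^sup>L (M i) h))"
        using a by (intro less_le_trans[OF _ L]) (simp add: ennreal_less_iff)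
      from less_LiminfD[OF this] show ?thesis
        by eventually_elim (use False in \<open>simp add: ennreal_less_iff\<close>)
    qed
  qed
  obtain B where B: "\<And>x. x \<in> topspace Y \<Longrightarrow> \<bar>f x\<bar> \<le> B"
    using f by (auto simp: C_b_def bounded_iff)
  have bnd: "bounded (h ` topspace Y)" if "\<And>x. x \<in> topspace Y \<Longrightarrow> \<bar>h x\<bar> \<le> 2 * B" for h :: "'a \<Rightarrow> real"
    using that by (auto simp: bounded_iff)
  \<comment> \<open>Shifting by a bound \<open>B\<close> of \<open>f\<close> makes both
    \<open>f\<close> and its negative nonnegative. All measures involved have total mass one, so the
    shift changes every integral by exactly \<open>B\<close>.\<close>
  have plus: "(\<lambda>x. B + f x) \<in> C_b Y" and minus: "(\<lambda>x. B - f x) \<in> C_b Y"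
    using f B by (auto simp: C_b_def intro!: continuous_intros bnd) (smt (verit))+
  have int: "integral\<^sup>L N (\<lambda>x. B + f x) = B + integral\<^sup>L N f" "integral\<^sup>L N (\<lambda>x. B - f x) = B - integral\<^sup>L N f"
    if N: "N \<in> radon_prob Y" for N
  proof -
    interpret prob_space N using N by (rule radon_probD)
    show "integral\<^sup>L N (\<lambda>x. B + f x) = B + integral\<^sup>L N f" "integral\<^sup>L N (\<lambda>x. B - f x) = B - integral\<^sup>L N f"
      using C_b_integrable[OF N f] by (simp_all add: prob_space)
  qed
  show ?thesis
  proof (rule order_tendstoI)
    fix a assume "a < integral\<^sup>L \<mu> f"
    then have "eventually (\<lambda>i. B + a < integral\<^sup>L (M i) (\<lambda>x. B + f x)) F"
      using B by (intro lower plus) (auto simp: int[OF \<mu>] abs_le_iff, smt (verit))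
    with M show "eventually (\<lambda>i. a < integral\<^sup>L (M i) f) F"
      by eventually_elim (simp add: int)
  next
    fix a assume "integral\<^sup>L \<mu> f < a"
    then have "eventually (\<lambda>i. B - a < integral\<^sup>L (M i) (\<lambda>x. B - f x)) F"
      using B by (intro lower minus) (auto simp: int[OF \<mu>] abs_le_iff)
    with M show "eventually (\<lambda>i. integral\<^sup>L (M i) f < a) F"
      by eventually_elim (simp add: int)
  qed
qed

subsection \<open>Limit points of equi-tight nets\<close>

lemma limitin_topology_generated_by:
  assumes "l \<in> \<Union>S" "\<And>U. U \<in> S \<Longrightarrow> l \<in> U \<Longrightarrow> eventually (\<lambda>i. f i \<in> U) F"
  shows "limitin (topology_generated_by S) f l F"
proof -
  have "l \<in> U \<Longrightarrow> eventually (\<lambda>i. f i \<in> U) F" if "generate_topology_on S U" for U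
    using that
  proof (induction rule: generate_topology_on.induct)
    case (Int a b)
    then show ?case by (auto intro: eventually_conj)
  next
    case (UN K)
    then obtain k where "k \<in> K" "l \<in> k" by auto
    then have "eventually (\<lambda>i. f i \<in> k) F" using UN by blast
    then show ?case by (rule eventually_mono) (use \<open>k \<in> K\<close> in auto)
  qed (use assms in auto)
  then show ?thesis
    using assms(1) by (auto simp: limitin_def openin_topology_generated_by_iff)
qed

lemma limitin_weak_topologyI:
  assumes "\<mu> \<in> radon_prob Y" "eventually (\<lambda>i. M i \<in> radon_prob Y) F"
    and "\<And>f. f \<in> C_b Y \<Longrightarrow> ((\<lambda>i. integral\<^sup>L (M i) f) \<longlongrightarrow> integral\<^sup>L \<mu> f) F"
  shows "limitin (weak_topology Y) M \<mu> F"
  unfolding weak_topology_def initial_topology_def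
proof (rule limitin_topology_generated_by)
  show "\<mu> \<in> \<Union>{{x \<in> radon_prob Y. f x \<in> U} |f U. f \<in> (\<lambda>f \<mu>. integral\<^sup>L \<mu> f) ` C_b Y \<and> open U}"
    using assms(1) topspace_weak_topology[of Y]
    by (simp add: weak_topology_def initial_topology_def topology_generated_by_topspace)
next
  fix W assume "W \<in> {{x \<in> radon_prob Y. f x \<in> U} |f U. f \<in> (\<lambda>f \<mu>. integral\<^sup>L \<mu> f) ` C_b Y \<and> open U}"
    and "\<mu> \<in> W"
  then obtain f U where W: "f \<in> C_b Y" "open U" "W = {x \<in> radon_prob Y. integral\<^sup>L x f \<in> U}"
    "integral\<^sup>L \<mu> f \<in> U"
    by auto
  then have "eventually (\<lambda>i. integral\<^sup>L (M i) f \<in> U) F"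
    using topological_tendstoD[OF assms(3)] by auto
  with assms(2) show "eventually (\<lambda>i. M i \<in> W) F"
    unfolding W(3) by eventually_elim simp
qed

lemma limitin_weak_topologyD:
  assumes "limitin (weak_topology Y) M \<mu> F"
  shows "\<mu> \<in> radon_prob Y" "eventually (\<lambda>i. M i \<in> radon_prob Y) F"
    and "f \<in> C_b Y \<Longrightarrow> ((\<lambda>i. integral\<^sup>L (M i) f) \<longlongrightarrow> integral\<^sup>L \<mu> f) F"
proof -
  show \<mu>: "\<mu> \<in> radon_prob Y"
    using limitin_topspace[OF assms] by (simp add: topspace_weak_topology)
  show "eventually (\<lambda>i. M i \<in> radon_prob Y) F"
    using assms \<mu> openin_topspace[of "weak_topology Y"]
    unfolding limitin_def topspace_weak_topology by blast
  assume f: "f \<in> C_b Y"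
  show "((\<lambda>i. integral\<^sup>L (M i) f) \<longlongrightarrow> integral\<^sup>L \<mu> f) F"
  proof (rule topological_tendstoI)
    fix U :: "real set" assume U: "open U" "integral\<^sup>L \<mu> f \<in> U"
    have "openin (weak_topology Y) {x \<in> radon_prob Y. integral\<^sup>L x f \<in> U}"
      unfolding weak_topology_def initial_topology_def
      using f U(1) by (intro topology_generated_by_Basis CollectI exI[of _ "\<lambda>\<mu>. integral\<^sup>L \<mu> f"] exI[of _ U]) auto
    then have "eventually (\<lambda>i. M i \<in> {x \<in> radon_prob Y. integral\<^sup>L x f \<in> U}) F"
      using assms \<mu> U(2) unfolding limitin_def by blast
    then show "eventually (\<lambda>i. integral\<^sup>L (M i) f \<in> U) F"
      by eventually_elim simp
  qed
qed

section \<open>Cluster points as limits of subnets\<close>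

lemma net_filter_neq_bot: "directed_set I le \<Longrightarrow> net_filter I le \<noteq> bot"
  by (auto simp: trivial_limit_def eventually_net_filter directed_set_def dest: reflp_onD)

text \<open>The pairs are ordered by \<open>le\<close> in the index and by reverse inclusion in the
  neighbourhood. Then every pair beyond \<open>(j, W)\<close> has its term of the net in
  \<open>W\<close>, and the first projection is the subnet map.\<close>

lemma net_limit_pointI:
  fixes x :: "'i \<Rightarrow> 'b"
  assumes I: "directed_set I le" and z: "z \<in> topspace Z"
    and cluster: "\<And>W i. openin Z W \<Longrightarrow> z \<in> W \<Longrightarrow> i \<in> I \<Longrightarrow> \<exists>j\<in>I. le i j \<and> x j \<in> W"
  shows "net_limit_point Z I le x z"
proof -
  define L where "L = {(i, W). i \<in> I \<and> openin Z W \<and> z \<in> W \<and> x i \<in> W}"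
  define leL :: "'i \<times> 'b set \<Rightarrow> 'i \<times> 'b set \<Rightarrow> bool" where "leL = (\<lambda>(i, W) (j, V). le i j \<and> V \<subseteq> W)"
  have refl: "\<And>i. i \<in> I \<Longrightarrow> le i i"
    and trans: "\<And>i j k. i \<in> I \<Longrightarrow> j \<in> I \<Longrightarrow> k \<in> I \<Longrightarrow> le i j \<Longrightarrow> le j k \<Longrightarrow> le i k"
    and dir: "\<And>i j. i \<in> I \<Longrightarrow> j \<in> I \<Longrightarrow> \<exists>k\<in>I. le i k \<and> le j k"
    using I by (auto simp: directed_set_def dest: reflp_onD transp_onD)
  have ex: "\<exists>j. (j, W) \<in> L \<and> le i j" if "openin Z W" "z \<in> W" "i \<in> I" for W i
    using cluster[OF that] that by (auto simp: L_def)
  have L: "directed_set L leL"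
    unfolding directed_set_def
  proof (intro conjI ballI)
    obtain i where "i \<in> I" using I by (auto simp: directed_set_def)
    then show "L \<noteq> {}" using ex[OF openin_topspace z] by auto
    show "reflp_on L leL" by (auto simp: L_def leL_def intro!: reflp_onI refl)
    show "transp_on L leL"
      by (rule transp_onI) (auto simp: L_def leL_def intro: trans)
    fix a b assume "a \<in> L" "b \<in> L"
    then obtain i W j V where ab: "a = (i, W)" "b = (j, V)" "i \<in> I" "j \<in> I" "openin Z W" "openin Z V"
      "z \<in> W" "z \<in> V"
      by (auto simp: L_def)
    obtain k where k: "k \<in> I" "le i k" "le j k" using dir[OF ab(3,4)] by auto
    \<comment> \<open>The term at \<open>k\<close> itself need not lie in
      \<open>W \<inter> V\<close>; the cluster property moves further along the net to an index
      where it does.\<close>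
    obtain m where "(m, W \<inter> V) \<in> L" "le k m" using ex[of "W \<inter> V" k] ab k by auto
    moreover have "m \<in> I" using \<open>(m, W \<inter> V) \<in> L\<close> by (auto simp: L_def)
    ultimately show "\<exists>c\<in>L. leL a c \<and> leL b c"
      using ab k by (intro bexI[of _ "(m, W \<inter> V)"]) (auto simp: leL_def intro: trans)
  qed
  have "subnet_map I le L leL fst"
    unfolding subnet_map_def
  proof (intro conjI ballI L)
    show "fst \<in> L \<rightarrow> I" by (auto simp: L_def)
    fix i assume i: "i \<in> I"
    obtain j where j: "(j, topspace Z) \<in> L" "le i j" using ex[OF openin_topspace z i] by auto
    then show "\<exists>l\<^sub>0\<in>L. \<forall>l\<in>L. leL l\<^sub>0 l \<longrightarrow> le i (fst l)"
      using i by (intro bexI[OF _ j(1)]) (auto simp: L_def leL_def intro: trans)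
  qed
  moreover have "limitin Z (\<lambda>l. x (fst l)) z (net_filter L leL)"
    unfolding limitin_def
  proof (intro conjI allI impI z)
    fix W assume W: "openin Z W \<and> z \<in> W"
    obtain i where "i \<in> I" using I by (auto simp: directed_set_def)
    then obtain j where "(j, W) \<in> L" using ex W by blast
    then show "eventually (\<lambda>l. x (fst l) \<in> W) (net_filter L leL)"
      unfolding eventually_net_filter[OF L]
      by (intro bexI[of _ "(j, W)"]) (auto simp: L_def leL_def)
  qed
  ultimately show ?thesis
    unfolding net_limit_point_def limit_along_subnet_def by blast
qed

text \<open>The limits along the ultrafilter inherit monotonicity and finite additivity on open sets
  from the measures \<open>H i\<close>, so Halmos' construction applies. The resulting measure is
  the limit along the ultrafilter, which refines the net, hence a cluster point.\<close>

theorem equi_tight_net_limit_point: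
  assumes Y: "Hausdorff_space Y" and I: "directed_set I le"
    and H: "\<And>i. i \<in> I \<Longrightarrow> H i \<in> radon_prob Y"
    and tight: "equi_tight Y (H ` I)"
  shows "\<exists>\<mu>. net_limit_point (weak_topology Y) I le H \<mu>"
proof -
  obtain U where U: "U \<noteq> bot" "U \<le> net_filter I le"
      and ultra: "\<And>P. eventually P U \<or> eventually (\<lambda>x. \<not> P x) U"
    using ultrafilter_exists[OF net_filter_neq_bot[OF I]] by metis
  have ev: "eventually (\<lambda>i. i \<in> I) U"
  proof (rule filter_leD[OF U(2)])
    show "eventually (\<lambda>i. i \<in> I) (net_filter I le)"
      using I unfolding eventually_net_filter[OF I] by (auto simp: directed_set_def)
  qed
  define \<nu> where "\<nu> A = Liminf U (\<lambda>i. emeasure (H i) A)" for A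
  have lim: "((\<lambda>i. emeasure (H i) A) \<longlongrightarrow> \<nu> A) U" for A
    unfolding \<nu>_def using U(1) ultra by (rule ultrafilter_tendsto_Liminf)
  have sets: "G \<in> sets (H i)" if "openin Y G" "i \<in> I" for G i
    using that H radon_probD(2) openin_sets_borel_of by fastforce
  interpret open_content Y \<nu>
  proof
    show "\<nu> {} = 0"
      using tendsto_unique[OF U(1) lim[of "{}"]] by simp
    fix G V assume GV: "openin Y G" "openin Y V"
    show "\<nu> G \<le> \<nu> V" if "G \<subseteq> V"
      using ev by (intro tendsto_le[OF U(1) lim lim], eventually_elim)
        (auto intro!: emeasure_mono that sets GV)
    show "\<nu> (G \<union> V) \<le> \<nu> G + \<nu> V"
      using ev by (intro tendsto_le[OF U(1) tendsto_add[OF lim lim] lim], eventually_elim)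
        (auto intro!: emeasure_subadditive sets GV)
    show "\<nu> G + \<nu> V \<le> \<nu> (G \<union> V)" if "disjnt G V"
      using ev by (intro tendsto_le[OF U(1) lim tendsto_add[OF lim lim]], eventually_elim)
        (use that in \<open>auto intro!: eq_refl plus_emeasure sets GV simp: disjnt_def\<close>)
  qed (rule Y)
  have \<mu>: "radon_extension \<in> radon_prob Y"
  proof (rule radon_extension_radon_prob)
    show "\<nu> (topspace Y) \<le> 1"
      using ev
    proof (intro tendsto_le[OF U(1) tendsto_const lim], eventually_elim)
      case (elim i)
      then interpret prob_space "H i" using H radon_probD by blast
      show ?case by (rule emeasure_le_1)
    qed
    fix e :: real assume e: "0 < e"
    then obtain K where K: "compactin Y K" "\<And>i. i \<in> I \<Longrightarrow> measure (H i) (topspace Y - K) \<le> e"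
      using tight by (auto simp: equi_tight_def)
    \<comment> \<open>Every open \<open>G\<close> around \<open>K\<close> has mass at least
      \<open>1 - e\<close> under all \<open>H i\<close>, uniformly in \<open>i\<close>, so the bound
      survives the limit.\<close>
    have "1 \<le> \<nu> G + ennreal e" if G: "openin Y G" "K \<subseteq> G" for G
      using ev
    proof (intro tendsto_le[OF U(1) tendsto_add[OF lim tendsto_const] tendsto_const], eventually_elim)
      case (elim i)
      then interpret prob_space "H i" using H radon_probD by blast
      have [simp]: "space (H i) = topspace Y" using elim H radon_probD by blast
      have "topspace Y - K \<in> events"
        using compactin_imp_closedin[OF Y K(1)] elim by (intro sets) auto
      then have "prob (topspace Y - G) \<le> prob (topspace Y - K)"
        using G by (intro finite_measure_mono) auto
      then have "prob (topspace Y - G) \<le> e" using K(2)[OF elim(2)] by simp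
      then show ?case
        using prob_compl[OF sets[OF G(1) elim(2)]] e
        by (simp add: emeasure_eq_measure flip: ennreal_plus ennreal_1)
    qed
    then show "\<exists>K. compactin Y K \<and> (\<forall>G. openin Y G \<longrightarrow> K \<subseteq> G \<longrightarrow> 1 \<le> \<nu> G + ennreal e)"
      using K(1) by blast
  qed
  have evH: "eventually (\<lambda>i. H i \<in> radon_prob Y) U"
    using ev by eventually_elim (rule H)
  have conv: "limitin (weak_topology Y) H radon_extension U"
    using \<mu> evH emeasure_radon_extension_le
    by (intro limitin_weak_topologyI tendsto_integral_if_open_le_Liminf) (auto simp: \<nu>_def)
  have "net_limit_point (weak_topology Y) I le H radon_extension"
  proof (rule net_limit_pointI[OF I])
    show "radon_extension \<in> topspace (weak_topology Y)" using \<mu> by (simp add: topspace_weak_topology)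
    fix W i assume W: "openin (weak_topology Y) W" "radon_extension \<in> W" and i: "i \<in> I"
    \<comment> \<open>Tails of the net and the event that \<open>H j\<close> lies in
      \<open>W\<close> both belong to the proper filter \<open>U\<close>, so they share an
      index.\<close>
    have "eventually (\<lambda>j. j \<in> I \<and> le i j) (net_filter I le)"
      using i by (auto simp: eventually_net_filter[OF I])
    then have "eventually (\<lambda>j. j \<in> I \<and> le i j) U" by (rule filter_leD[OF U(2)])
    moreover have "eventually (\<lambda>j. H j \<in> W) U"
      using conv W by (auto simp: limitin_def)
    ultimately have "eventually (\<lambda>j. j \<in> I \<and> le i j \<and> H j \<in> W) U"
      by eventually_elim simp
    then show "\<exists>j\<in>I. le i j \<and> H j \<in> W"
      using eventually_happens'[OF U(1)] by blast
  qed
  then show ?thesis by blast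
qed

subsection \<open>Tightness in the path space\<close>

text \<open>A path outside the product leaves some \<open>K t\<close> with \<open>t\<close> in
  \<open>D\<close>. The exceptional masses are weighted along an enumeration of \<open>D\<close>, so
  that their sum is at most \<open>e\<close>.\<close>

lemma measure_path_space_compl_le:
  assumes N: "N \<in> radon_prob (path_space X D)" and "countable D" "Hausdorff_space X" "0 < e"
    and K: "\<And>t. t \<in> D \<Longrightarrow> compactin X (K t)"
      "\<And>t. t \<in> D \<Longrightarrow> measure (distr N (borel_of X) (\<lambda>\<eta>. \<eta> t)) (topspace X - K t) \<le> e * (1/2) ^ Suc (to_nat_on D t)"
  shows "measure N (topspace (path_space X D) - (\<Pi>\<^sub>E t\<in>D. K t)) \<le> e"
proof -
  interpret prob_space N using N by (rule radon_probD)
  have sp: "space N = topspace (path_space X D)" using N by (rule radon_probD)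
  define B where "B t = {\<eta> \<in> space N. \<eta> t \<notin> K t}" for t
  \<comment> \<open>Reindexing the union over \<open>D\<close> by natural numbers: each
    \<open>A n\<close> is a single \<open>B t\<close>, or empty when \<open>n\<close> is not the
    code of an element of \<open>D\<close>.\<close>
  define A where "A n = (\<Union>t\<in>{t\<in>D. to_nat_on D t = n}. B t)" for n
  have ev: "(\<lambda>\<eta>. \<eta> t) \<in> N \<rightarrow>\<^sub>M borel_of X" if "t \<in> D" for t
    using continuous_map_measurable_borel_of[OF continuous_map_product_projection[OF that], of "\<lambda>_. X"]
      measurable_cong_sets[OF radon_probD(2)[OF N] refl] by blast
  have Ks: "topspace X - K t \<in> sets (borel_of X)" if "t \<in> D" for t
    using compactin_imp_closedin[OF assms(3) K(1)[OF that]] by (intro openin_sets_borel_of) auto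
  have B_eq: "B t = (\<lambda>\<eta>. \<eta> t) -` (topspace X - K t) \<inter> space N" if "t \<in> D" for t
    using that by (auto simp: sp B_def)
  have Bs: "B t \<in> sets N" if "t \<in> D" for t
    unfolding B_eq[OF that] using ev[OF that] Ks[OF that] by (rule measurable_sets)
  have A_cases: "A n = {} \<or> (\<exists>t\<in>D. to_nat_on D t = n \<and> A n = B t)" for n
  proof (cases "\<exists>t\<in>D. to_nat_on D t = n")
    case True
    then obtain t where t: "t \<in> D" "to_nat_on D t = n" by auto
    then have "{t\<in>D. to_nat_on D t = n} = {t}"
      using inj_on_to_nat_on[OF assms(2)] by (auto dest: inj_onD)
    then show ?thesis using t by (auto simp: A_def)
  qed (auto simp: A_def)
  have As: "A n \<in> sets N" for n
    using A_cases[of n] Bs by (elim disjE bexE conjE) simp_all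
  have Am: "emeasure N (A n) \<le> ennreal (e * (1/2) ^ Suc n)" for n
    using A_cases[of n]
  proof (elim disjE bexE conjE)
    fix t assume t: "t \<in> D" "to_nat_on D t = n" "A n = B t"
    have "prob (B t) \<le> e * (1/2) ^ Suc n"
      using K(2)[OF t(1)] t(2) measure_distr[OF ev Ks, OF t(1) t(1)] B_eq[OF t(1)] by simp
    then show ?thesis using t(3) by (simp add: emeasure_eq_measure ennreal_leI)
  qed simp
  have sub: "topspace (path_space X D) - (\<Pi>\<^sub>E t\<in>D. K t) \<subseteq> (\<Union>n. A n)"
    by (auto simp: A_def B_def sp PiE_iff)
  have "emeasure N (topspace (path_space X D) - (\<Pi>\<^sub>E t\<in>D. K t)) \<le> emeasure N (\<Union>n. A n)"
    using As by (intro emeasure_mono sub) auto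
  also have "\<dots> \<le> (\<Sum>n. emeasure N (A n))"
    using As by (intro emeasure_subadditive_countably) auto
  also have "\<dots> \<le> (\<Sum>n. ennreal (e * (1/2) ^ Suc n))"
    using Am by (intro suminf_le) auto
  also have "\<dots> = ennreal e"
    using \<open>0 < e\<close> sums_mult[OF power_half_series, of e] by (intro suminf_ennreal_eq) auto
  finally show ?thesis using \<open>0 < e\<close> by (simp add: emeasure_eq_measure)
qed

lemma equi_tight_path_space:
  assumes X: "Hausdorff_space X" and D: "countable D"
    and H: "\<And>i. i \<in> I \<Longrightarrow> H i \<in> radon_prob (path_space X D)"
    and tight: "\<And>t. t \<in> D \<Longrightarrow> equi_tight X ((\<lambda>i. distr (H i) (borel_of X) (\<lambda>\<eta>. \<eta> t)) ` I)"
  shows "equi_tight (path_space X D) (H ` I)"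
  unfolding equi_tight_def
proof (intro allI impI)
  fix e :: real assume e: "0 < e"
  have "\<exists>K. compactin X K \<and> (\<forall>i\<in>I. measure (distr (H i) (borel_of X) (\<lambda>\<eta>. \<eta> t)) (topspace X - K)
      \<le> e * (1/2) ^ Suc (to_nat_on D t))" if "t \<in> D" for t
    using tight[OF that, unfolded equi_tight_def, rule_format, of "e * (1/2) ^ Suc (to_nat_on D t)"] e
    by auto
  then obtain K where K: "\<And>t. t \<in> D \<Longrightarrow> compactin X (K t)"
    "\<And>t i. t \<in> D \<Longrightarrow> i \<in> I \<Longrightarrow> measure (distr (H i) (borel_of X) (\<lambda>\<eta>. \<eta> t)) (topspace X - K t)
      \<le> e * (1/2) ^ Suc (to_nat_on D t)"
    by metis
  show "\<exists>K. compactin (path_space X D) K \<and> (\<forall>\<mu>\<in>H ` I. measure \<mu> (topspace (path_space X D) - K) \<le> e)"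
  \<comment> \<open>The product of the compact sets is compact by Tychonoff's theorem.\<close>
  proof (intro exI[of _ "\<Pi>\<^sub>E t\<in>D. K t"] conjI ballI)
    show "compactin (path_space X D) (\<Pi>\<^sub>E t\<in>D. K t)" using K(1) by (auto simp: compactin_PiE)
    fix \<mu> assume "\<mu> \<in> H ` I"
    then obtain i where i: "i \<in> I" "\<mu> = H i" by auto
    show "measure \<mu> (topspace (path_space X D) - (\<Pi>\<^sub>E t\<in>D. K t)) \<le> e"
      unfolding i(2) using K i(1) by (intro measure_path_space_compl_le[OF H[OF i(1)] D X e]) auto
  qed
qed

subsection \<open>Suprema of bounded continuous functions\<close>

lemma C_bI:
  assumes "continuous_map Y euclideanreal f" "\<And>x. x \<in> topspace Y \<Longrightarrow> \<bar>f x\<bar> \<le> B"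
  shows "f \<in> C_b Y"
  using assms by (auto simp: C_b_def bounded_iff)

lemma C_bE:
  assumes "f \<in> C_b Y"
  obtains B where "continuous_map Y euclideanreal f" "\<And>x. x \<in> topspace Y \<Longrightarrow> \<bar>f x\<bar> \<le> B"
  using assms by (auto simp: C_b_def bounded_iff)

lemma C_b_const: "(\<lambda>_. c) \<in> C_b Y"
  by (rule C_bI[of _ _ "\<bar>c\<bar>"]) auto

lemma C_b_add:
  assumes "f \<in> C_b Y" "g \<in> C_b Y"
  shows "(\<lambda>x. f x + g x) \<in> C_b Y"
proof -
  obtain A where A: "continuous_map Y euclideanreal f" "\<And>x. x \<in> topspace Y \<Longrightarrow> \<bar>f x\<bar> \<le> A"
    using assms(1) by (rule C_bE) blast
  obtain B where B: "continuous_map Y euclideanreal g" "\<And>x. x \<in> topspace Y \<Longrightarrow> \<bar>g x\<bar> \<le> B"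
    using assms(2) by (rule C_bE) blast
  have "\<bar>f x + g x\<bar> \<le> A + B" if "x \<in> topspace Y" for x
    using A(2)[OF that] B(2)[OF that] by linarith
  then show ?thesis
    using A(1) B(1) by (intro C_bI continuous_map_add)
qed

lemma C_b_sum:
  assumes "finite S" "\<And>i. i \<in> S \<Longrightarrow> f i \<in> C_b Y"
  shows "(\<lambda>x. \<Sum>i\<in>S. f i x) \<in> C_b Y"
  using assms by (induction S rule: finite_induct) (auto intro: C_b_const C_b_add)

definition C_b_minorants :: "'a topology \<Rightarrow> ('a \<Rightarrow> ennreal) \<Rightarrow> ('a \<Rightarrow> real) set" where
  "C_b_minorants Y g = {h \<in> C_b Y. \<forall>x\<in>topspace Y. 0 \<le> h x \<and> ennreal (h x) \<le> g x}"

text \<open>The reverse inequality is built into \<open>C_b_minorants\<close>, so this is equality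
  with the supremum. It is stronger than lower semicontinuity when the space is not completely
  regular, and it is stable under suprema and finite sums, the operations from which the action is
  built.\<close>

definition C_b_approximable :: "'a topology \<Rightarrow> ('a \<Rightarrow> ennreal) \<Rightarrow> bool" where
  "C_b_approximable Y g \<longleftrightarrow> (\<forall>x\<in>topspace Y. g x \<le> (SUP h\<in>C_b_minorants Y g. ennreal (h x)))"

lemma zero_in_C_b_minorants: "(\<lambda>_. 0) \<in> C_b_minorants Y g"
  by (simp add: C_b_minorants_def C_b_const)

lemma C_b_approximable_cong:
  assumes "\<And>x. x \<in> topspace Y \<Longrightarrow> g x = g' x" "C_b_approximable Y g'"
  shows "C_b_approximable Y g"
proof -
  have "C_b_minorants Y g = C_b_minorants Y g'"
    using assms(1) by (auto simp: C_b_minorants_def)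
  then show ?thesis using assms by (simp add: C_b_approximable_def)
qed

lemma C_b_approximable_C_b:
  assumes "h \<in> C_b Y" "\<And>x. x \<in> topspace Y \<Longrightarrow> 0 \<le> h x"
  shows "C_b_approximable Y (\<lambda>x. ennreal (h x))"
  unfolding C_b_approximable_def
  using assms by (auto intro!: SUP_upper2[of h] simp: C_b_minorants_def)

lemma C_b_approximable_SUP:
  assumes "\<And>a. a \<in> A \<Longrightarrow> C_b_approximable Y (g a)"
  shows "C_b_approximable Y (\<lambda>x. SUP a\<in>A. g a x)"
  unfolding C_b_approximable_def
proof (intro ballI SUP_least)
  fix x a assume x: "x \<in> topspace Y" and a: "a \<in> A"
  have "C_b_minorants Y (g a) \<subseteq> C_b_minorants Y (\<lambda>x. SUP a\<in>A. g a x)"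
    using a by (auto simp: C_b_minorants_def intro: SUP_upper2)
  then have "(SUP h\<in>C_b_minorants Y (g a). ennreal (h x)) \<le>
      (SUP h\<in>C_b_minorants Y (\<lambda>x. SUP a\<in>A. g a x). ennreal (h x))"
    by (intro SUP_subset_mono) auto
  then show "g a x \<le> (SUP h\<in>C_b_minorants Y (\<lambda>x. SUP a\<in>A. g a x). ennreal (h x))"
    using assms[OF a] x by (auto simp: C_b_approximable_def intro: order_trans)
qed

lemma C_b_approximable_add:
  assumes "C_b_approximable Y f" "C_b_approximable Y g"
  shows "C_b_approximable Y (\<lambda>x. f x + g x)"
  unfolding C_b_approximable_def
proof
  fix x assume x: "x \<in> topspace Y"
  have "f x + g x \<le> (SUP h\<in>C_b_minorants Y f. ennreal (h x)) + (SUP k\<in>C_b_minorants Y g. ennreal (k x))"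
    using assms x by (intro add_mono) (auto simp: C_b_approximable_def)
  also have "\<dots> \<le> (SUP h\<in>C_b_minorants Y (\<lambda>x. f x + g x). ennreal (h x))"
  proof (rule SUP_add_SUP_le_ennreal)
    fix h k assume hk: "h \<in> C_b_minorants Y f" "k \<in> C_b_minorants Y g"
    then have "(\<lambda>x. h x + k x) \<in> C_b_minorants Y (\<lambda>x. f x + g x)"
      by (auto simp: C_b_minorants_def intro: C_b_add add_mono)
    moreover have "ennreal (h x) + ennreal (k x) = ennreal (h x + k x)"
      using hk x by (auto simp: C_b_minorants_def)
    ultimately show "ennreal (h x) + ennreal (k x) \<le> (SUP h\<in>C_b_minorants Y (\<lambda>x. f x + g x). ennreal (h x))"
      by (auto intro: SUP_upper2)
  qed (use zero_in_C_b_minorants in blast)+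
  finally show "f x + g x \<le> (SUP h\<in>C_b_minorants Y (\<lambda>x. f x + g x). ennreal (h x))" .
qed

lemma C_b_approximable_sum:
  assumes "finite S" "\<And>i. i \<in> S \<Longrightarrow> C_b_approximable Y (g i)"
  shows "C_b_approximable Y (\<lambda>x. \<Sum>i\<in>S. g i x)"
  using assms
proof (induction S rule: finite_induct)
  case empty
  show ?case using C_b_approximable_C_b[OF C_b_const[of 0]] by simp
qed (auto intro: C_b_approximable_add)

text \<open>Take a continuous minorant \<open>k\<close> with \<open>k x\<close> above
  \<open>a\<close> and keep only its excess \<open>max 0 (k - a)\<close>: where this is positive,
  \<open>g\<close> exceeds \<open>a\<close>.\<close>

lemma C_b_approximable_superlevel:
  assumes "C_b_approximable Y g" "0 \<le> a" "x \<in> topspace Y" "ennreal a < g x"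
  obtains h where "h \<in> C_b Y" "\<And>y. y \<in> topspace Y \<Longrightarrow> 0 \<le> h y" "0 < h x"
    "\<And>y. y \<in> topspace Y \<Longrightarrow> 0 < h y \<Longrightarrow> ennreal a < g y"
proof -
  have "ennreal a < (SUP h\<in>C_b_minorants Y g. ennreal (h x))"
    using assms by (auto simp: C_b_approximable_def intro: less_le_trans)
  then obtain k where k: "k \<in> C_b_minorants Y g" "ennreal a < ennreal (k x)"
    by (auto simp: less_SUP_iff)
  have "k \<in> C_b Y" using k(1) by (simp add: C_b_minorants_def)
  then obtain B where B: "continuous_map Y euclideanreal k" "\<And>x. x \<in> topspace Y \<Longrightarrow> \<bar>k x\<bar> \<le> B"
    by (rule C_bE) blast
  show thesis
  proof (rule that)
    have "\<bar>max 0 (k y - a)\<bar> \<le> B + a" if "y \<in> topspace Y" for y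
      using B(2)[OF that] assms(2) by auto
    then show "(\<lambda>y. max 0 (k y - a)) \<in> C_b Y"
      using B(1) by (intro C_bI[of _ _ "B + a"] continuous_map_real_max continuous_map_diff) auto
    show "0 < max 0 (k x - a)" using k(2) assms(2) by (simp add: ennreal_less_iff)
    fix y assume y: "y \<in> topspace Y" "0 < max 0 (k y - a)"
    then have "ennreal a < ennreal (k y)" using assms(2) by (simp add: ennreal_less_iff)
    also have "\<dots> \<le> g y" using k y by (auto simp: C_b_minorants_def)
    finally show "ennreal a < g y" .
  qed simp
qed

lemma openin_superlevel_C_b_approximable:
  assumes "C_b_approximable Y g" "0 \<le> a"
  shows "openin Y {x\<in>topspace Y. ennreal a < g x}"
proof (subst openin_subopen, intro ballI)
  fix x assume "x \<in> {x\<in>topspace Y. ennreal a < g x}"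
  then have x: "x \<in> topspace Y" "ennreal a < g x" by auto
  obtain h where h: "h \<in> C_b Y" "0 < h x" "\<And>y. y \<in> topspace Y \<Longrightarrow> 0 < h y \<Longrightarrow> ennreal a < g y"
    using C_b_approximable_superlevel[OF assms x] by metis
  have "openin Y {y\<in>topspace Y. h y \<in> {0<..}}"
    using h(1) by (intro openin_continuous_map_preimage) (auto simp: C_b_def)
  then show "\<exists>T. openin Y T \<and> x \<in> T \<and> T \<subseteq> {x\<in>topspace Y. ennreal a < g x}"
    using h x by (intro exI[of _ "{y\<in>topspace Y. h y \<in> {0<..}}"]) auto
qed

lemma borel_measurable_C_b_approximable:
  assumes "C_b_approximable Y g" "\<mu> \<in> radon_prob Y"
  shows "g \<in> borel_measurable \<mu>"
proof (rule borel_measurableI_greater)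
  fix y :: ennreal
  show "{x\<in>space \<mu>. y < g x} \<in> sets \<mu>"
  proof (cases y)
    case (real a)
    then show ?thesis
      using openin_superlevel_C_b_approximable[OF assms(1), of a]
      by (auto simp: radon_probD[OF assms(2)] intro: openin_sets_borel_of)
  qed simp
qed

section \<open>Lower semicontinuity of mass on unions of cozero sets\<close>

text \<open>A Urysohn function without normality of the space. Finitely many of the given functions
  are jointly positive on \<open>K\<close>; their sum \<open>s\<close> attains a positive minimum
  there, and dividing by it and truncating at 1 gives the separating function.\<close>

lemma compact_cozero_Urysohn:
  assumes K: "compactin Y K"
    and cover: "\<And>x. x \<in> K \<Longrightarrow> \<exists>h\<in>C_b Y. (\<forall>y\<in>topspace Y. 0 \<le> h y) \<and> 0 < h x \<and> (\<forall>y\<in>topspace Y. 0 < h y \<longrightarrow> y \<in> G)"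
  obtains f where "f \<in> C_b Y" "\<And>y. y \<in> topspace Y \<Longrightarrow> 0 \<le> f y \<and> f y \<le> 1" "\<And>y. y \<in> K \<Longrightarrow> f y = 1"
    "\<And>y. y \<in> topspace Y \<Longrightarrow> y \<notin> G \<Longrightarrow> f y = 0"
\<comment> \<open>The minimum over \<open>K\<close> exists only for nonempty
  \<open>K\<close>.\<close>
proof (cases "K = {}")
  case True
  then show thesis using that[of "\<lambda>_. 0"] by (simp add: C_b_const)
next
  case False
  have KY: "K \<subseteq> topspace Y" using K by (rule compactin_subset_topspace)
  define HH where "HH = {h\<in>C_b Y. (\<forall>y\<in>topspace Y. 0 \<le> h y) \<and> (\<forall>y\<in>topspace Y. 0 < h y \<longrightarrow> y \<in> G)}"
  let ?U = "\<lambda>h. {y\<in>topspace Y. h y \<in> {0::real<..}}"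
  have op: "openin Y U" if "U \<in> ?U ` HH" for U
    using that by (auto simp: HH_def C_b_def intro!: openin_continuous_map_preimage[where Y=euclideanreal, of _ _ "{0<..}", simplified])
  have cov: "K \<subseteq> \<Union>(?U ` HH)"
  proof
    fix x assume x: "x \<in> K"
    then obtain h where "h \<in> C_b Y" "\<forall>y\<in>topspace Y. 0 \<le> h y" "0 < h x" "\<forall>y\<in>topspace Y. 0 < h y \<longrightarrow> y \<in> G"
      using cover by blast
    then have "h \<in> HH" "x \<in> ?U h" using x KY by (auto simp: HH_def)
    then show "x \<in> \<Union>(?U ` HH)" by blast
  qed
  have "\<exists>\<F>. finite \<F> \<and> \<F> \<subseteq> ?U ` HH \<and> K \<subseteq> \<Union>\<F>"
    by (rule compactinD[OF K op cov])
  then obtain \<F> where \<F>: "finite \<F>" "\<F> \<subseteq> ?U ` HH" "K \<subseteq> \<Union>\<F>"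
    by (elim exE conjE)
  then obtain S where S: "finite S" "S \<subseteq> HH" "\<F> = ?U ` S" by (meson finite_subset_image)
  define s where "s x = (\<Sum>h\<in>S. h x)" for x
  have sC: "s \<in> C_b Y"
    unfolding s_def using S by (intro C_b_sum) (auto simp: HH_def)
  then have s: "continuous_map Y euclideanreal s" by (simp add: C_b_def)
  have s_nonneg: "0 \<le> s y" if "y \<in> topspace Y" for y
    unfolding s_def using S that by (intro sum_nonneg) (auto simp: HH_def)
  have s_pos: "0 < s y" if "y \<in> K" for y
  proof -
    have "y \<in> \<Union>\<F>" using \<F>(3) that by blast
    then obtain h where "h \<in> S" "0 < h y" using S(3) by auto
    then show ?thesis
      unfolding s_def using S KY that by (intro sum_pos2[of S h]) (auto simp: HH_def)
  qed
  have s_zero: "s y = 0" if "y \<in> topspace Y" "y \<notin> G" for y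
    unfolding s_def using S that by (intro sum.neutral) (force simp: HH_def order.order_iff_strict)
  have "compact (s ` K)"
    using image_compactin[OF K s] by simp
  then obtain x0 where x0: "x0 \<in> K" "\<And>y. y \<in> K \<Longrightarrow> s x0 \<le> s y"
    using compact_attains_inf[of "s ` K"] False by auto
  define f where "f y = min 1 (s y / s x0)" for y
  have pos: "0 < s x0" using x0 s_pos by simp
  show thesis
  proof (rule that)
    have bnd: "0 \<le> f y \<and> f y \<le> 1" if "y \<in> topspace Y" for y
      using s_nonneg[OF that] pos by (auto simp: f_def)
    then show "\<And>y. y \<in> topspace Y \<Longrightarrow> 0 \<le> f y \<and> f y \<le> 1" .
    have "continuous_map Y euclideanreal f"
      unfolding f_def using s pos
      by (intro continuous_map_real_min continuous_map_real_divide) auto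
    then show "f \<in> C_b Y"
      using bnd by (intro C_bI[of _ _ 1]) fastforce+
    show "f y = 1" if "y \<in> K" for y
      using x0(2)[OF that] pos by (simp add: f_def field_simps)
    show "f y = 0" if "y \<in> topspace Y" "y \<notin> G" for y
      using s_zero[OF that] by (simp add: f_def)
  qed
qed

text \<open>Inner regularity provides a compact \<open>K\<close> carrying almost all of
  \<open>G\<close>, and the preceding construction a function \<open>f\<close> in
  \<open>C_b Y\<close> between the indicators of \<open>K\<close> and \<open>G\<close>. Its
  integrals converge; they bound \<open>M i G\<close> from below and \<open>\<mu> G\<close> from
  above up to \<open>e\<close>.\<close>

lemma emeasure_le_Liminf_cozero:
  assumes Y: "Hausdorff_space Y" and lim: "limitin (weak_topology Y) M \<mu> F" and F: "F \<noteq> bot" and G: "openin Y G"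
    and cover: "\<And>x. x \<in> G \<Longrightarrow> \<exists>h\<in>C_b Y. (\<forall>y\<in>topspace Y. 0 \<le> h y) \<and> 0 < h x \<and> (\<forall>y\<in>topspace Y. 0 < h y \<longrightarrow> y \<in> G)"
  shows "emeasure \<mu> G \<le> Liminf F (\<lambda>i. emeasure (M i) G)"
proof (rule ennreal_le_epsilon)
  fix e :: real assume e: "0 < e"
  have \<mu>: "\<mu> \<in> radon_prob Y" and M: "eventually (\<lambda>i. M i \<in> radon_prob Y) F"
    using limitin_weak_topologyD[OF lim] by auto
  interpret prob_space \<mu> using \<mu> by (rule radon_probD)
  have Gs: "G \<in> sets N" if "N \<in> radon_prob Y" for N
    using radon_probD(2)[OF that] openin_sets_borel_of[OF G] by simp
  obtain K where K: "compactin Y K" "K \<subseteq> G" "prob (G - K) < e"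
    using \<mu> Gs[OF \<mu>] e unfolding radon_prob_def by blast
  obtain f where f: "f \<in> C_b Y" "\<And>y. y \<in> topspace Y \<Longrightarrow> 0 \<le> f y \<and> f y \<le> 1" "\<And>y. y \<in> K \<Longrightarrow> f y = 1"
    "\<And>y. y \<in> topspace Y \<Longrightarrow> y \<notin> G \<Longrightarrow> f y = 0"
    using compact_cozero_Urysohn[OF K(1) cover[OF subsetD[OF K(2)]]] by metis
  have int_nonneg: "AE x in N. 0 \<le> f x" if "N \<in> radon_prob Y" for N
    using f(2) radon_probD(3)[OF that] by auto
  have nn: "(\<integral>\<^sup>+x. ennreal (f x) \<partial>N) = ennreal (integral\<^sup>L N f)" if "N \<in> radon_prob Y" for N
    by (rule nn_integral_eq_integral[OF C_b_integrable[OF that f(1)] int_nonneg[OF that]])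
  have "emeasure \<mu> G \<le> (\<integral>\<^sup>+x. ennreal (f x) + indicator (G - K) x \<partial>\<mu>)"
  proof -
    have "emeasure \<mu> G = (\<integral>\<^sup>+x. indicator G x \<partial>\<mu>)" using Gs[OF \<mu>] by simp
    also have "\<dots> \<le> (\<integral>\<^sup>+x. ennreal (f x) + indicator (G - K) x \<partial>\<mu>)"
      using f(3) by (intro nn_integral_mono) (auto simp: indicator_def)
    finally show ?thesis .
  qed
  also have "\<dots> \<le> ennreal (integral\<^sup>L \<mu> f) + ennreal e"
  proof -
    have "K \<in> events"
      using closedin_sets_borel_of[OF compactin_imp_closedin[OF Y K(1)]] radon_probD(2)[OF \<mu>] by simp
    then have "G - K \<in> events" using Gs[OF \<mu>] by auto
    then have "(\<integral>\<^sup>+x. ennreal (f x) + indicator (G - K) x \<partial>\<mu>) = ennreal (integral\<^sup>L \<mu> f) + emeasure \<mu> (G - K)"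
      using borel_measurable_integrable[OF C_b_integrable[OF \<mu> f(1)]]
      by (subst nn_integral_add) (auto simp: nn[OF \<mu>])
    also have "\<dots> \<le> ennreal (integral\<^sup>L \<mu> f) + ennreal e"
      using K(3) by (intro add_left_mono) (simp add: emeasure_eq_measure ennreal_leI)
    finally show ?thesis .
  qed
  also have "ennreal (integral\<^sup>L \<mu> f) = Liminf F (\<lambda>i. ennreal (integral\<^sup>L (M i) f))"
    using tendsto_ennrealI[OF limitin_weak_topologyD(3)[OF lim f(1)]] F
    by (intro lim_imp_Liminf[symmetric])
  also have "\<dots> \<le> Liminf F (\<lambda>i. emeasure (M i) G)"
    using M
  proof (intro Liminf_mono, eventually_elim)
    case (elim i)
    have "ennreal (integral\<^sup>L (M i) f) = (\<integral>\<^sup>+x. ennreal (f x) \<partial>(M i))" using nn[OF elim(2)] by simp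
    also have "\<dots> \<le> (\<integral>\<^sup>+x. indicator G x \<partial>(M i))"
      using f(2,4) by (intro nn_integral_mono) (auto simp: radon_probD(3)[OF elim(2)] indicator_def)
    also have "\<dots> = emeasure (M i) G" using Gs[OF elim(2)] by simp
    finally show ?case .
  qed
  finally show "emeasure \<mu> G \<le> Liminf F (\<lambda>i. emeasure (M i) G) + ennreal e"
    by (simp add: add_right_mono)
qed

lemma nn_integral_C_b_approximable_le_Liminf:
  assumes Y: "Hausdorff_space Y" and lim: "limitin (weak_topology Y) M \<mu> F" and F: "F \<noteq> bot" and g: "C_b_approximable Y g"
  shows "(\<integral>\<^sup>+x. g x \<partial>\<mu>) \<le> Liminf F (\<lambda>i. \<integral>\<^sup>+x. g x \<partial>(M i))"
proof (rule nn_integral_le_Liminf_superlevel)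
  note \<mu> = limitin_weak_topologyD(1)[OF lim] and M = limitin_weak_topologyD(2)[OF lim]
  show "g \<in> borel_measurable \<mu>" using g \<mu> by (rule borel_measurable_C_b_approximable)
  show "eventually (\<lambda>i. g \<in> borel_measurable (M i)) F"
    using M by eventually_elim (rule borel_measurable_C_b_approximable[OF g])
  fix a :: real assume a: "0 \<le> a"
  let ?G = "{x\<in>topspace Y. ennreal a < g x}"
  have "emeasure \<mu> ?G \<le> Liminf F (\<lambda>i. emeasure (M i) ?G)"
    by (rule emeasure_le_Liminf_cozero[OF Y lim F openin_superlevel_C_b_approximable[OF g a]])
      (use C_b_approximable_superlevel[OF g a] in \<open>smt (verit, best) mem_Collect_eq\<close>)
  also have "\<dots> = Liminf F (\<lambda>i. emeasure (M i) {x\<in>space (M i). ennreal a < g x})"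
    using M by (intro Liminf_eq, eventually_elim) (simp add: radon_probD(3))
  finally show "emeasure \<mu> {x\<in>space \<mu>. ennreal a < g x} \<le>
      Liminf F (\<lambda>i. emeasure (M i) {x\<in>space (M i). ennreal a < g x})"
    by (simp add: radon_probD(3)[OF \<mu>])
qed

subsection \<open>Lower semicontinuity of the action\<close>

text \<open>The power is increasing with inverse \<open>c powr (1/p)\<close>: a real value below the
  power of the supremum has its root below the supremum, hence below some \<open>f a\<close>. An
  empty family is consistent with this, since \<open>0 powr p = 0\<close>.\<close>

lemma ennpowr_SUP:
  assumes "0 < p" "\<And>a. a \<in> A \<Longrightarrow> 0 \<le> f a"
  shows "ennpowr (SUP a\<in>A. ennreal (f a)) p = (SUP a\<in>A. ennreal (f a powr p))"
proof (rule antisym)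
  let ?S = "SUP a\<in>A. ennreal (f a)"
  show "ennpowr ?S p \<le> (SUP a\<in>A. ennreal (f a powr p))"
  proof (rule dense_le)
    fix y assume y: "y < ennpowr ?S p"
    then obtain c where c: "y = ennreal c" "0 \<le> c" by (cases y) auto
    have root: "(c powr (1/p)) powr p = c" using assms(1) c by (simp add: powr_powr)
    have "ennreal (c powr (1/p)) < ?S"
    proof (cases ?S)
      case (real s)
      then have "c < s powr p" using y c by (simp add: ennpowr_def ennreal_less_iff)
      have "c powr (1/p) < s"
      proof (rule ccontr)
        assume "\<not> c powr (1/p) < s"
        then have "s powr p \<le> (c powr (1/p)) powr p"
          using assms(1) real by (intro powr_mono2) auto
        then show False using root \<open>c < s powr p\<close> by simp
      qed
      then show ?thesis using real by (simp add: ennreal_less_iff)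
    next
      case top
      show ?thesis unfolding top by simp
    qed
    then obtain a where a: "a \<in> A" "c powr (1/p) < f a"
      by (auto simp: less_SUP_iff ennreal_less_iff)
    then have "c \<le> f a powr p"
      using root powr_mono2[of p "c powr (1/p)" "f a"] assms(1) by simp
    then show "y \<le> (SUP a\<in>A. ennreal (f a powr p))"
      using a(1) c by (auto intro!: SUP_upper2 ennreal_leI)
  qed
  show "(SUP a\<in>A. ennreal (f a powr p)) \<le> ennpowr ?S p"
  proof (rule SUP_least)
    fix a assume a: "a \<in> A"
    have "ennreal (f a) \<le> ?S" using a by (rule SUP_upper)
    then show "ennreal (f a powr p) \<le> ennpowr ?S p"
      using assms(1) assms(2)[OF a]
      by (cases ?S) (auto simp: ennpowr_def intro!: ennreal_leI powr_mono2)
  qed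
qed

lemma semidistance_powr_C_b:
  assumes "semidistance_on (topspace X) \<delta>" "\<And>x y. x \<in> topspace X \<Longrightarrow> y \<in> topspace X \<Longrightarrow> \<delta> x y \<le> B"
    and "continuous_map (prod_topology X X) euclideanreal (\<lambda>(x, y). \<delta> x y)"
    and "s \<in> D" "t \<in> D" "0 < p" "0 < w"
  shows "(\<lambda>\<eta>. \<delta> (\<eta> s) (\<eta> t) powr p / w) \<in> C_b (path_space X D)"
proof -
  let ?Y = "path_space X D"
  have nn: "0 \<le> \<delta> (\<eta> s) (\<eta> t)" "\<delta> (\<eta> s) (\<eta> t) \<le> B" if "\<eta> \<in> topspace ?Y" for \<eta>
    using assms that by (auto simp: semidistance_on_def PiE_iff)
  have "continuous_map ?Y (prod_topology X X) (\<lambda>\<eta>. (\<eta> s, \<eta> t))"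
    using assms(4,5) by (intro continuous_map_pairedI continuous_map_product_projection)
  from continuous_map_compose[OF this assms(3)]
  have "continuous_map ?Y euclideanreal (\<lambda>\<eta>. \<delta> (\<eta> s) (\<eta> t))" by (simp add: o_def)
  \<comment> \<open>Continuity of the power is invoked only on the half-line, so the distance is
    first regarded as a map into it.\<close>
  then have "continuous_map ?Y (top_of_set {0..}) (\<lambda>\<eta>. \<delta> (\<eta> s) (\<eta> t))"
    using nn by (auto simp: continuous_map_in_subtopology)
  moreover have "continuous_map (top_of_set {0..}) euclideanreal (\<lambda>x. x powr p / w)"
    using assms(6,7) by (auto intro!: continuous_intros continuous_on_powr')
  ultimately have "continuous_map ?Y euclideanreal ((\<lambda>x. x powr p / w) \<circ> (\<lambda>\<eta>. \<delta> (\<eta> s) (\<eta> t)))"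
    by (rule continuous_map_compose)
  then have "continuous_map ?Y euclideanreal (\<lambda>\<eta>. \<delta> (\<eta> s) (\<eta> t) powr p / w)"
    by (simp add: o_def)
  moreover have "\<bar>\<delta> (\<eta> s) (\<eta> t) powr p / w\<bar> \<le> B powr p / w" if "\<eta> \<in> topspace ?Y" for \<eta>
    using nn[OF that] assms(6,7) by (auto intro!: divide_right_mono powr_mono2)
  ultimately show ?thesis by (rule C_bI)
qed

text \<open>The power and the division by a positive weight commute with the supremum over the
  semidistances, so each summand is a supremum of nonnegative bounded continuous functions. Finite
  sums and the supremum over all partitions preserve approximability.\<close>

lemma C_b_approximable_p_action:
  assumes "ext_metric_top_space X d" "1 < p" "D' \<subseteq> D"
  shows "C_b_approximable (path_space X D) (\<lambda>\<eta>. p_action d p \<eta> D')"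
proof -
  let ?Y = "path_space X D"
  let ?term = "\<lambda>(t::nat \<Rightarrow> real) i \<eta>. ennpowr (d (\<eta> (t (Suc i))) (\<eta> (t i))) p / ennreal ((t (Suc i) - t i) powr (p - 1))"
  let ?P = "{(n::nat, t::nat \<Rightarrow> real). (\<forall>i\<le>n. t i \<in> D') \<and> (\<forall>i<n. t i < t (Suc i))}"
  obtain \<Delta> where \<Delta>: "\<forall>\<delta>\<in>\<Delta>. semidistance_on (topspace X) \<delta> \<and>
        (\<exists>B. \<forall>x\<in>topspace X. \<forall>y\<in>topspace X. \<delta> x y \<le> B) \<and>
        continuous_map (prod_topology X X) euclideanreal (\<lambda>(x, y). \<delta> x y)"
      "\<forall>x\<in>topspace X. \<forall>y\<in>topspace X. d x y = (SUP \<delta>\<in>\<Delta>. ennreal (\<delta> x y))"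
    using assms(1) unfolding ext_metric_top_space_def by (elim conjE exE)
  have semi: "semidistance_on (topspace X) \<delta>"
    and bound: "\<exists>B. \<forall>x\<in>topspace X. \<forall>y\<in>topspace X. \<delta> x y \<le> B"
    and cont: "continuous_map (prod_topology X X) euclideanreal (\<lambda>(x, y). \<delta> x y)" if "\<delta> \<in> \<Delta>" for \<delta>
    using \<Delta>(1) that by simp_all
  have d: "d x y = (SUP \<delta>\<in>\<Delta>. ennreal (\<delta> x y))" if "x \<in> topspace X" "y \<in> topspace X" for x y
    using \<Delta>(2) that by simp
  have step: "C_b_approximable ?Y (?term t i)" if "t (Suc i) \<in> D" "t i \<in> D" "t i < t (Suc i)" for t i
  proof (rule C_b_approximable_cong)
    let ?w = "(t (Suc i) - t i) powr (p - 1)"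
    have w: "0 < ?w" using that(3) by simp
    show "C_b_approximable ?Y (\<lambda>\<eta>. SUP \<delta>\<in>\<Delta>. ennreal (\<delta> (\<eta> (t (Suc i))) (\<eta> (t i)) powr p / ?w))"
    proof (intro C_b_approximable_SUP C_b_approximable_C_b)
      fix \<delta> assume \<delta>: "\<delta> \<in> \<Delta>"
      then obtain B where "\<forall>x\<in>topspace X. \<forall>y\<in>topspace X. \<delta> x y \<le> B" using bound by blast
      then show "(\<lambda>\<eta>. \<delta> (\<eta> (t (Suc i))) (\<eta> (t i)) powr p / ?w) \<in> C_b ?Y"
        using that w assms(2) by (intro semidistance_powr_C_b[OF semi[OF \<delta>] _ cont[OF \<delta>], of B]) auto
    qed (use w in auto)
    fix \<eta> assume "\<eta> \<in> topspace ?Y"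
    then have \<eta>: "\<eta> (t (Suc i)) \<in> topspace X" "\<eta> (t i) \<in> topspace X"
      using that by (auto simp: PiE_iff)
    have "?term t i \<eta> = (SUP \<delta>\<in>\<Delta>. ennreal (\<delta> (\<eta> (t (Suc i))) (\<eta> (t i)) powr p)) / ennreal ?w"
      using \<eta> semi assms(2) by (subst d, simp, simp, subst ennpowr_SUP) (auto simp: semidistance_on_def)
    also have "\<dots> = (SUP \<delta>\<in>\<Delta>. ennreal (\<delta> (\<eta> (t (Suc i))) (\<eta> (t i)) powr p / ?w))"
      using w by (simp add: SUP_divide_ennreal divide_ennreal)
    finally show "?term t i \<eta> = (SUP \<delta>\<in>\<Delta>. ennreal (\<delta> (\<eta> (t (Suc i))) (\<eta> (t i)) powr p / ?w))" .
  qed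
  have "C_b_approximable ?Y (\<lambda>\<eta>. SUP a\<in>?P. \<Sum>i<fst a. ?term (snd a) i \<eta>)"
    using assms(3) by (intro C_b_approximable_SUP C_b_approximable_sum step) (auto simp: subset_iff)
  moreover have "p_action d p \<eta> D' = (SUP a\<in>?P. \<Sum>i<fst a. ?term (snd a) i \<eta>)" for \<eta>
  proof -
    \<comment> \<open>Turns the set of sums over partitions into an image over pairs
      \<open>(n, t)\<close>, matching the indexed supremum.\<close>
    have setcompr: "{f n t |n t. P n t} = (\<lambda>a. f (fst a) (snd a)) ` {(n, t). P n t}"
      for f :: "nat \<Rightarrow> (nat \<Rightarrow> real) \<Rightarrow> ennreal" and P
      by force
    show ?thesis unfolding p_action_def by (rule arg_cong[OF setcompr])
  qed
  ultimately show ?thesis by simp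
qed

theorem theorem4p6:
  fixes X :: "'a topology" and d :: "'a \<Rightarrow> 'a \<Rightarrow> ennreal"
    and p T :: real and D :: "real set"
    and I :: "'i set" and le :: "'i \<Rightarrow> 'i \<Rightarrow> bool"
    and H :: "'i \<Rightarrow> (real \<Rightarrow> 'a) measure"
  assumes "ext_metric_top_space X d"
    and "1 < p" and "0 < T" and "countable D"
    and "directed_set I le"
    and "\<And>i. i \<in> I \<Longrightarrow> H i \<in> radon_prob (path_space X D)"
    and "\<And>t. t \<in> D \<Longrightarrow> equi_tight X ((\<lambda>i. distr (H i) (borel_of X) (\<lambda>\<eta>. \<eta> t)) ` I)"
  shows "(\<exists>\<mu>. net_limit_point (weak_topology (path_space X D)) I le H \<mu>) \<and>
    (\<forall>\<mu> (L :: 'l set) leL \<beta>.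
       limit_along_subnet (weak_topology (path_space X D)) I le H L leL \<beta> \<mu> \<longrightarrow>
       (\<forall>D'\<subseteq>D. (\<integral>\<^sup>+\<eta>. p_action d p \<eta> D' \<partial>\<mu>)
          \<le> Liminf (net_filter L leL) (\<lambda>l. \<integral>\<^sup>+\<eta>. p_action d p \<eta> D' \<partial>(H (\<beta> l)))))"
proof -
  have X: "Hausdorff_space X" using assms(1) by (simp add: ext_metric_top_space_def)
  have Y: "Hausdorff_space (path_space X D)" using X by (simp add: Hausdorff_space_product_topology)
  have "\<exists>\<mu>. net_limit_point (weak_topology (path_space X D)) I le H \<mu>"
  proof (rule equi_tight_net_limit_point[OF Y assms(5,6)])
    show "equi_tight (path_space X D) (H ` I)"
      by (rule equi_tight_path_space[OF X assms(4,6,7)])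
  qed
  moreover have "(\<integral>\<^sup>+\<eta>. p_action d p \<eta> D' \<partial>\<mu>)
      \<le> Liminf (net_filter L leL) (\<lambda>l. \<integral>\<^sup>+\<eta>. p_action d p \<eta> D' \<partial>(H (\<beta> l)))"
    if lim: "limit_along_subnet (weak_topology (path_space X D)) I le H L leL \<beta> \<mu>" and D': "D' \<subseteq> D"
    for \<mu> leL \<beta> D' and L :: "'l set"
  proof (rule nn_integral_C_b_approximable_le_Liminf[OF Y])
    show "limitin (weak_topology (path_space X D)) (\<lambda>l. H (\<beta> l)) \<mu> (net_filter L leL)"
      using lim by (simp add: limit_along_subnet_def)
    show "net_filter L leL \<noteq> bot"
      using lim by (intro net_filter_neq_bot) (simp add: limit_along_subnet_def subnet_map_def)
    show "C_b_approximable (path_space X D) (\<lambda>\<eta>. p_action d p \<eta> D')"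
      by (rule C_b_approximable_p_action[OF assms(1,2) D'])
  qed
  ultimately show ?thesis by blast
qed

end
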